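(* Let $\lambda_1,\lambda_2\in\mathbb R$, $\Delta t>0$, $t_k=k\Delta t$, and let $\mathbb U_k=(\mathbf E_k^\top,\mathbf H_k^\top)^\top$, $k=0,1,2,\dots$, be the numerical approximation of the linear stochastic Maxwell's equation with additive noise $$\mathrm d\mathbf E-\nabla\times\mathbf H\,\mathrm dt=\lambda_1\mathbf e\,\mathrm dW,\qquad \mathrm d\mathbf H+\nabla\times\mathbf E\,\mathrm dt=\lambda_2\mathbf e\,\mathrm dW,\qquad \mathbf e=(1,1,1)^\top,$$ given by the exponential integrator $\mathbb U_0=\mathbb U(0)$, $\mathbb U_{k+1}=\mathbf S(\Delta t)\mathbb U_k+\mathbf S(\Delta t)\mathbb G\,\Delta W_k$. Then the averaged divergence is exactly preserved: $$\mathbb E[\mathrm{div}(\mathbf E_k)]=\mathbb E[\mathrm{div}(\mathbf E_{k-1})],\qquad \mathbb E[\mathrm{div}(\mathbf H_k)]=\mathbb E[\mathrm{div}(\mathbf H_{k-1})]$$ for all $k\in\{1,2,\dots\}$.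
   Context: $\mathcal O\subset\mathbb R^3$ is a bounded, simply connected domain with smooth boundary and unit outward normal $\mathbf n$; $\epsilon=\mu=1$. $V=L^2(\mathcal O)^3\times L^2(\mathcal O)^3$ with its usual $L^2$ inner product. $H(\mathrm{curl},\mathcal O)=\{\mathbf v\in L^2(\mathcal O)^3:\nabla\times\mathbf v\in L^2(\mathcal O)^3\}$, $H_0(\mathrm{curl},\mathcal O)=\{\mathbf v\in H(\mathrm{curl},\mathcal O):\mathbf n\times\mathbf v|_{\partial\mathcal O}=0\}$. The Maxwell operator $A(\mathbf E,\mathbf H)=(\nabla\times\mathbf H,-\nabla\times\mathbf E)$ with domain $D(A)=H_0(\mathrm{curl},\mathcal O)\times H(\mathrm{curl},\mathcal O)$ (perfect conductor boundary condition) is skew-adjoint and generates the unitary $C_0$-group $\mathbf S(t)=e^{tA}$ on $V$; $\|v\|_{D(A)}^2=\|v\|_V^2+\|Av\|_V^2$. $U=L^2(\mathcal O;\mathbb R)$; $Q$ is a symmetric nonnegative trace class operator on $U$ with orthonormal eigenbasis $(e_k)_{k\ge1}$, $Qe_k=\eta_ke_k$, and $W(t)=\sum_kQ^{1/2}e_k\beta_k(t)$ is a $Q$-Wiener process, $(\beta_k)$ being independent standard real Brownian motions on a stochastic basis $(\Omega,\mathscr F,\{\mathscr F_t\}_{t\ge0},\mathbb P)$. $\Delta W_k=W(t_{k+1})-W(t_k)$. $\mathbb G=(\lambda_1,\lambda_1,\lambda_1,\lambda_2,\lambda_2,\lambda_2)^\top$ acts by $\mathbb Gu=(\lambda_1u,\lambda_1u,\lambda_1u,\lambda_2u,\lambda_2u,\lambda_2u)^\top\in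 V$ for $u\in U$. The initial value $\mathbb U(0)$ is a $D(A)$-valued $\mathscr F_0$-measurable random variable with $\mathbb E[\|\mathbb U(0)\|_{D(A)}^p]<\infty$ for all $p\ge1$. The divergence of an $L^2(\mathcal O)^3$ field is understood in the sense of distributions (as an element of $H^{-1}(\mathcal O)$), and the expectations are those of $H^{-1}(\mathcal O)$-valued random variables. *)

theory Defs
  imports "HOL-Probability.Probability"
begin

text \<open>
  Conventions.  \<open>\<O>\<close> is a subset of \<open>real^3\<close>.  Elements of \<open>L\<^sup>2(\<O>; 'b)\<close> are represented by
  functions on \<open>real^3\<close>; only the values on \<open>\<O>\<close> matter, and equality in \<open>L\<^sup>2\<close> is equality almost
  everywhere on \<open>\<O>\<close> (\<open>ae_eq\<close>).  The space \<open>V = L\<^sup>2(\<O>)\<^sup>3 \<times> L\<^sup>2(\<O>)\<^sup>3\<close> is \<open>L2 \<O>\<close> at value type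
  \<open>(real^3) \<times> (real^3)\<close>, whose inner product is the sum of those of the two components.
\<close>

type_synonym pt = "real^3"
type_synonym em = "(real^3) \<times> (real^3)"

section \<open>Differential calculus for smooth functions\<close>

definition pd :: "3 \<Rightarrow> (pt \<Rightarrow> 'b::real_normed_vector) \<Rightarrow> pt \<Rightarrow> 'b" where
  "pd i f x = frechet_derivative f (at x) (axis i 1)"

primrec Ck_on :: "nat \<Rightarrow> pt set \<Rightarrow> (pt \<Rightarrow> 'b::real_normed_vector) \<Rightarrow> bool" where
  "Ck_on 0 = (\<lambda>N f. continuous_on N f)"
| "Ck_on (Suc k) = (\<lambda>N f. (\<forall>x\<in>N. f differentiable (at x)) \<and> (\<forall>i. Ck_on k N (pd i f)))"

definition smooth_on :: "pt set \<Rightarrow> (pt \<Rightarrow> 'b::real_normed_vector) \<Rightarrow> bool" where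
  "smooth_on N f \<longleftrightarrow> (\<forall>k. Ck_on k N f)"

definition grad :: "(pt \<Rightarrow> real) \<Rightarrow> pt \<Rightarrow> pt" where
  "grad f x = (\<chi> i. pd i f x)"

definition curl :: "(pt \<Rightarrow> pt) \<Rightarrow> pt \<Rightarrow> pt" where
  "curl v x = vector [pd 2 v x $ 3 - pd 3 v x $ 2,
                      pd 3 v x $ 1 - pd 1 v x $ 3,
                      pd 1 v x $ 2 - pd 2 v x $ 1]"

definition test_fun :: "pt set \<Rightarrow> (pt \<Rightarrow> 'b::real_normed_vector) set" where
  "test_fun \<O> = {\<phi>. smooth_on UNIV \<phi> \<and> compact (closure {x. \<phi> x \<noteq> 0})
                      \<and> closure {x. \<phi> x \<noteq> 0} \<subseteq> \<O>}"

text \<open>The boundary is described locally by defining functions: near each boundary point, \<open>\<O>\<close> is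
  a sublevel set \<open>{g < 0}\<close> with \<open>g\<close> smooth and \<open>grad g \<noteq> 0\<close> (so that
  \<open>grad g / |grad g|\<close> is the unit outward normal).\<close>

definition smooth_boundary :: "pt set \<Rightarrow> bool" where
  "smooth_boundary \<O> \<longleftrightarrow>
    (\<forall>p\<in>frontier \<O>. \<exists>N (g :: pt \<Rightarrow> real). open N \<and> p \<in> N \<and> smooth_on N g
        \<and> (\<forall>x\<in>N. grad g x \<noteq> 0) \<and> \<O> \<inter> N = {x\<in>N. g x < 0})"

definition smooth_domain :: "pt set \<Rightarrow> bool" where
  "smooth_domain \<O> \<longleftrightarrow> open \<O> \<and> \<O> \<noteq> {} \<and> connected \<O> \<and> bounded \<O>
      \<and> simply_connected \<O> \<and> smooth_boundary \<O>"

section \<open>\<open>L\<^sup>2\<close> spaces\<close>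

definition L2 :: "pt set \<Rightarrow> (pt \<Rightarrow> 'b::euclidean_space) set" where
  "L2 \<O> = {f. f \<in> borel_measurable (lebesgue_on \<O>)
              \<and> integrable (lebesgue_on \<O>) (\<lambda>x. (norm (f x))\<^sup>2)}"

definition ae_eq :: "pt set \<Rightarrow> (pt \<Rightarrow> 'b) \<Rightarrow> (pt \<Rightarrow> 'b) \<Rightarrow> bool" where
  "ae_eq \<O> f g \<longleftrightarrow> (AE x in lebesgue_on \<O>. f x = g x)"

definition l2_inner :: "pt set \<Rightarrow> (pt \<Rightarrow> 'b::euclidean_space) \<Rightarrow> (pt \<Rightarrow> 'b) \<Rightarrow> real" where
  "l2_inner \<O> f g = (\<integral>x. f x \<bullet> g x \<partial>lebesgue_on \<O>)"

definition l2_norm :: "pt set \<Rightarrow> (pt \<Rightarrow> 'b::euclidean_space) \<Rightarrow> real" where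
  "l2_norm \<O> f = sqrt (l2_inner \<O> f f)"

definition bounded_op ::
    "pt set \<Rightarrow> ((pt \<Rightarrow> 'b::euclidean_space) \<Rightarrow> (pt \<Rightarrow> 'b)) \<Rightarrow> bool" where
  "bounded_op \<O> R \<longleftrightarrow>
      (\<forall>u\<in>L2 \<O>. R u \<in> L2 \<O>)
    \<and> (\<forall>u\<in>L2 \<O>. \<forall>v\<in>L2 \<O>. ae_eq \<O> u v \<longrightarrow> ae_eq \<O> (R u) (R v))
    \<and> (\<forall>u\<in>L2 \<O>. \<forall>v\<in>L2 \<O>. \<forall>a b :: real.
          ae_eq \<O> (R (\<lambda>x. a *\<^sub>R u x + b *\<^sub>R v x)) (\<lambda>x. a *\<^sub>R R u x + b *\<^sub>R R v x))
    \<and> (\<exists>C. \<forall>u\<in>L2 \<O>. l2_norm \<O> (R u) \<le> C * l2_norm \<O> u)"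

definition sym_nonneg_op ::
    "pt set \<Rightarrow> ((pt \<Rightarrow> 'b::euclidean_space) \<Rightarrow> (pt \<Rightarrow> 'b)) \<Rightarrow> bool" where
  "sym_nonneg_op \<O> R \<longleftrightarrow> bounded_op \<O> R
    \<and> (\<forall>u\<in>L2 \<O>. \<forall>v\<in>L2 \<O>. l2_inner \<O> (R u) v = l2_inner \<O> u (R v))
    \<and> (\<forall>u\<in>L2 \<O>. 0 \<le> l2_inner \<O> (R u) u)"

definition orthonormal_basis :: "pt set \<Rightarrow> (nat \<Rightarrow> pt \<Rightarrow> 'b::euclidean_space) \<Rightarrow> bool" where
  "orthonormal_basis \<O> e \<longleftrightarrow> (\<forall>k. e k \<in> L2 \<O>)
    \<and> (\<forall>j k. l2_inner \<O> (e j) (e k) = (if j = k then 1 else 0))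
    \<and> (\<forall>u\<in>L2 \<O>. (\<forall>k. l2_inner \<O> u (e k) = 0) \<longrightarrow> ae_eq \<O> u (\<lambda>x. 0))"

text \<open>For symmetric nonnegative operators, trace class means that the trace series converges for
  every orthonormal basis (equivalently, for one).\<close>

definition trace_class_op ::
    "pt set \<Rightarrow> ((pt \<Rightarrow> 'b::euclidean_space) \<Rightarrow> (pt \<Rightarrow> 'b)) \<Rightarrow> bool" where
  "trace_class_op \<O> Q \<longleftrightarrow> sym_nonneg_op \<O> Q
    \<and> (\<forall>f. orthonormal_basis \<O> f \<longrightarrow> summable (\<lambda>k. l2_inner \<O> (Q (f k)) (f k)))"

definition is_sqrt_op ::
    "pt set \<Rightarrow> ((pt \<Rightarrow> 'b::euclidean_space) \<Rightarrow> (pt \<Rightarrow> 'b))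
            \<Rightarrow> ((pt \<Rightarrow> 'b) \<Rightarrow> (pt \<Rightarrow> 'b)) \<Rightarrow> bool" where
  "is_sqrt_op \<O> R Q \<longleftrightarrow> sym_nonneg_op \<O> R \<and> (\<forall>u\<in>L2 \<O>. ae_eq \<O> (R (R u)) (Q u))"

section \<open>Sobolev spaces and the Maxwell operator\<close>

definition is_weak_grad :: "pt set \<Rightarrow> (pt \<Rightarrow> real) \<Rightarrow> (pt \<Rightarrow> pt) \<Rightarrow> bool" where
  "is_weak_grad \<O> u g \<longleftrightarrow> g \<in> L2 \<O> \<and>
    (\<forall>\<psi>\<in>test_fun \<O>. \<forall>i. l2_inner \<O> u (pd i \<psi>) = - l2_inner \<O> (\<lambda>x. g x $ i) \<psi>)"

definition H1 :: "pt set \<Rightarrow> (pt \<Rightarrow> real) set" where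
  "H1 \<O> = {u\<in>L2 \<O>. \<exists>g. is_weak_grad \<O> u g}"

definition H1_vec :: "pt set \<Rightarrow> (pt \<Rightarrow> pt) set" where
  "H1_vec \<O> = {v. \<forall>i. (\<lambda>x. v x $ i) \<in> H1 \<O>}"

definition is_weak_curl :: "pt set \<Rightarrow> (pt \<Rightarrow> pt) \<Rightarrow> (pt \<Rightarrow> pt) \<Rightarrow> bool" where
  "is_weak_curl \<O> v w \<longleftrightarrow> w \<in> L2 \<O> \<and>
    (\<forall>\<psi>\<in>test_fun \<O>. l2_inner \<O> w \<psi> = l2_inner \<O> v (curl \<psi>))"

definition Hcurl :: "pt set \<Rightarrow> (pt \<Rightarrow> pt) set" where
  "Hcurl \<O> = {v\<in>L2 \<O>. \<exists>w. is_weak_curl \<O> v w}"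

text \<open>The distributional curl of \<open>v \<in> Hcurl \<O>\<close>; it is unique up to null sets.\<close>

definition weak_curl :: "pt set \<Rightarrow> (pt \<Rightarrow> pt) \<Rightarrow> (pt \<Rightarrow> pt)" where
  "weak_curl \<O> v = (SOME w. is_weak_curl \<O> v w)"

text \<open>The tangential trace \<open>n \<times> v\<close> of \<open>v \<in> H(curl)\<close> is an element of \<open>H\<^sup>-\<^sup>1\<^sup>/\<^sup>2\<close> of the boundary and is
  defined by Green's formula: the duality pairing of \<open>n \<times> v\<close> with the boundary trace of
  \<open>\<phi> \<in> H\<^sup>1(\<O>)\<^sup>3\<close> is the number below.  For \<open>v\<close> smooth up to the boundary it is the surface integral
  of \<open>(n \<times> v) \<bullet> \<phi>\<close>.\<close>

definition tangential_trace :: "pt set \<Rightarrow> (pt \<Rightarrow> pt) \<Rightarrow> (pt \<Rightarrow> pt) \<Rightarrow> real" where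
  "tangential_trace \<O> v \<phi> = l2_inner \<O> (weak_curl \<O> v) \<phi> - l2_inner \<O> v (weak_curl \<O> \<phi>)"

definition H0curl :: "pt set \<Rightarrow> (pt \<Rightarrow> pt) set" where
  "H0curl \<O> = {v\<in>Hcurl \<O>. \<forall>\<phi>\<in>H1_vec \<O>. tangential_trace \<O> v \<phi> = 0}"

definition Efld :: "(pt \<Rightarrow> em) \<Rightarrow> pt \<Rightarrow> pt" where
  "Efld u x = fst (u x)"

definition Hfld :: "(pt \<Rightarrow> em) \<Rightarrow> pt \<Rightarrow> pt" where
  "Hfld u x = snd (u x)"

definition maxwell_dom :: "pt set \<Rightarrow> (pt \<Rightarrow> em) set" where
  "maxwell_dom \<O> = {u. Efld u \<in> H0curl \<O> \<and> Hfld u \<in> Hcurl \<O>}"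

definition maxwell :: "pt set \<Rightarrow> (pt \<Rightarrow> em) \<Rightarrow> (pt \<Rightarrow> em)" where
  "maxwell \<O> u = (\<lambda>x. (weak_curl \<O> (Hfld u) x, - weak_curl \<O> (Efld u) x))"

definition graph_norm :: "pt set \<Rightarrow> (pt \<Rightarrow> em) \<Rightarrow> real" where
  "graph_norm \<O> u = sqrt ((l2_norm \<O> u)\<^sup>2 + (l2_norm \<O> (maxwell \<O> u))\<^sup>2)"

definition unitary_C0_group :: "pt set \<Rightarrow> (real \<Rightarrow> (pt \<Rightarrow> em) \<Rightarrow> (pt \<Rightarrow> em)) \<Rightarrow> bool" where
  "unitary_C0_group \<O> S \<longleftrightarrow>
      (\<forall>t. bounded_op \<O> (S t))
    \<and> (\<forall>t. \<forall>u\<in>L2 \<O>. \<forall>v\<in>L2 \<O>. l2_inner \<O> (S t u) (S t v) = l2_inner \<O> u v)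
    \<and> (\<forall>u\<in>L2 \<O>. ae_eq \<O> (S 0 u) u)
    \<and> (\<forall>s t. \<forall>u\<in>L2 \<O>. ae_eq \<O> (S (s + t) u) (S s (S t u)))
    \<and> (\<forall>u\<in>L2 \<O>. ((\<lambda>t. l2_norm \<O> (\<lambda>x. S t u x - u x)) \<longlongrightarrow> 0) (at 0))"

text \<open>The infinitesimal generator of \<open>S\<close> is exactly the operator \<open>maxwell \<O>\<close> with domain
  \<open>maxwell_dom \<O>\<close>, i.e. \<open>S t = exp (t A)\<close>.\<close>

definition generated_by_maxwell :: "pt set \<Rightarrow> (real \<Rightarrow> (pt \<Rightarrow> em) \<Rightarrow> (pt \<Rightarrow> em)) \<Rightarrow> bool" where
  "generated_by_maxwell \<O> S \<longleftrightarrow>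
    (\<forall>u\<in>L2 \<O>. \<forall>w\<in>L2 \<O>.
       ((\<lambda>h. l2_norm \<O> (\<lambda>x. (S h u x - u x) /\<^sub>R h - w x)) \<longlongrightarrow> 0) (at 0)
         \<longleftrightarrow> u \<in> maxwell_dom \<O> \<and> ae_eq \<O> w (maxwell \<O> u))"

section \<open>Vector-valued random variables and expectations\<close>

text \<open>\<open>C\<close> is a linear space of functions with (semi)norm \<open>N\<close>.  Random variables with values in
  \<open>C\<close> are strongly measurable, i.e. pointwise limits of simple functions; all spaces to which this
  is applied are separable, where this is the same as Borel measurability.\<close>

definition random_elt ::
    "'a measure \<Rightarrow> ('y \<Rightarrow> 'b::real_vector) set \<Rightarrow> (('y \<Rightarrow> 'b) \<Rightarrow> real) \<Rightarrow> ('a \<Rightarrow> 'y \<Rightarrow> 'b) \<Rightarrow> bool" where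
  "random_elt M C N X \<longleftrightarrow> (\<forall>\<omega>\<in>space M. X \<omega> \<in> C) \<and>
    (\<exists>s. (\<forall>n. simple_function M (s n) \<and> (\<forall>\<omega>\<in>space M. s n \<omega> \<in> C))
       \<and> (\<forall>\<omega>\<in>space M. (\<lambda>n. N (\<lambda>y. X \<omega> y - s n \<omega> y)) \<longlonglongrightarrow> 0))"

definition simple_expectation :: "'a measure \<Rightarrow> ('a \<Rightarrow> 'y \<Rightarrow> 'b::real_vector) \<Rightarrow> 'y \<Rightarrow> 'b" where
  "simple_expectation M s = (\<lambda>y. \<Sum>c\<in>s ` space M. measure M (s -` {c} \<inter> space M) *\<^sub>R c y)"

definition has_expectation ::
    "'a measure \<Rightarrow> ('y \<Rightarrow> 'b::real_vector) set \<Rightarrow> (('y \<Rightarrow> 'b) \<Rightarrow> real)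
        \<Rightarrow> ('a \<Rightarrow> 'y \<Rightarrow> 'b) \<Rightarrow> ('y \<Rightarrow> 'b) \<Rightarrow> bool" where
  "has_expectation M C N X m \<longleftrightarrow> random_elt M C N X \<and> m \<in> C \<and>
    (\<exists>s. (\<forall>n. simple_function M (s n) \<and> (\<forall>\<omega>\<in>space M. s n \<omega> \<in> C))
       \<and> (\<lambda>n. \<integral>\<^sup>+\<omega>. ennreal (N (\<lambda>y. X \<omega> y - s n \<omega> y)) \<partial>M) \<longlonglongrightarrow> 0
       \<and> (\<lambda>n. N (\<lambda>y. simple_expectation M (s n) y - m y)) \<longlonglongrightarrow> 0)"

section \<open>Distributional divergence in \<open>H\<^sup>-\<^sup>1(\<O>)\<close>\<close>

text \<open>\<open>H\<^sup>-\<^sup>1(\<O>)\<close>, the dual of \<open>H\<^sub>0\<^sup>1(\<O>)\<close> (the closure of the test functions in the \<open>H\<^sup>1\<close> norm), as a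
  space of distributions: linear functionals on the test functions that are bounded in the \<open>H\<^sup>1\<close>
  norm, with the dual norm.  Distributions are set to 0 off \<open>test_fun \<O>\<close>, so that equality of
  distributions is \<open>=\<close>.\<close>

type_synonym distr = "(pt \<Rightarrow> real) \<Rightarrow> real"

definition h1_norm :: "pt set \<Rightarrow> (pt \<Rightarrow> real) \<Rightarrow> real" where
  "h1_norm \<O> \<phi> = sqrt ((l2_norm \<O> \<phi>)\<^sup>2 + (l2_norm \<O> (grad \<phi>))\<^sup>2)"

definition Hm1 :: "pt set \<Rightarrow> distr set" where
  "Hm1 \<O> = {T. (\<forall>\<phi>. \<phi> \<notin> test_fun \<O> \<longrightarrow> T \<phi> = 0)
      \<and> (\<forall>\<phi>\<in>test_fun \<O>. \<forall>\<psi>\<in>test_fun \<O>. \<forall>a b. T (\<lambda>x. a * \<phi> x + b * \<psi> x) = a * T \<phi> + b * T \<psi>)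
      \<and> (\<exists>C. \<forall>\<phi>\<in>test_fun \<O>. \<bar>T \<phi>\<bar> \<le> C * h1_norm \<O> \<phi>)}"

definition Hm1_norm :: "pt set \<Rightarrow> distr \<Rightarrow> real" where
  "Hm1_norm \<O> T = (SUP \<phi>\<in>{\<phi>\<in>test_fun \<O>. h1_norm \<O> \<phi> \<le> 1}. \<bar>T \<phi>\<bar>)"

definition div_distr :: "pt set \<Rightarrow> (pt \<Rightarrow> pt) \<Rightarrow> distr" where
  "div_distr \<O> v = (\<lambda>\<phi>. if \<phi> \<in> test_fun \<O> then - l2_inner \<O> v (grad \<phi>) else 0)"

definition Hm1_integrable :: "'a measure \<Rightarrow> pt set \<Rightarrow> ('a \<Rightarrow> distr) \<Rightarrow> bool" where
  "Hm1_integrable M \<O> X \<longleftrightarrow> (\<exists>m. has_expectation M (Hm1 \<O>) (Hm1_norm \<O>) X m)"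

definition Hm1_expectation :: "'a measure \<Rightarrow> pt set \<Rightarrow> ('a \<Rightarrow> distr) \<Rightarrow> distr" where
  "Hm1_expectation M \<O> X = (THE m. has_expectation M (Hm1 \<O>) (Hm1_norm \<O>) X m)"

section \<open>The driving noise\<close>

definition stochastic_basis :: "'a measure \<Rightarrow> (real \<Rightarrow> 'a measure) \<Rightarrow> bool" where
  "stochastic_basis M \<F> \<longleftrightarrow> prob_space M
    \<and> (\<forall>t\<ge>0. subalgebra M (\<F> t))
    \<and> (\<forall>s t. 0 \<le> s \<longrightarrow> s \<le> t \<longrightarrow> sets (\<F> s) \<subseteq> sets (\<F> t))"

definition std_brownian_motion ::
    "'a measure \<Rightarrow> (real \<Rightarrow> 'a measure) \<Rightarrow> (real \<Rightarrow> 'a \<Rightarrow> real) \<Rightarrow> bool" where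
  "std_brownian_motion M \<F> b \<longleftrightarrow>
      (\<forall>t\<ge>0. b t \<in> borel_measurable (\<F> t))
    \<and> (AE \<omega> in M. b 0 \<omega> = 0)
    \<and> (AE \<omega> in M. continuous_on {0..} (\<lambda>t. b t \<omega>))
    \<and> (\<forall>s t. 0 \<le> s \<longrightarrow> s < t \<longrightarrow>
          distributed M lborel (\<lambda>\<omega>. b t \<omega> - b s \<omega>) (normal_density 0 (sqrt (t - s))))
    \<and> (\<forall>s t. 0 \<le> s \<longrightarrow> s < t \<longrightarrow>
          prob_space.indep_set M (sets (\<F> s))
            {(\<lambda>\<omega>. b t \<omega> - b s \<omega>) -` B \<inter> space M | B. B \<in> sets borel})"

text \<open>Mutually independent Brownian motions; the last clause makes the joint increments of the whole
  family independent of the past, which is what is needed for the increments of the resulting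
  \<open>Q\<close>-Wiener process to be independent of the past.\<close>

definition indep_brownian_motions ::
    "'a measure \<Rightarrow> (real \<Rightarrow> 'a measure) \<Rightarrow> (nat \<Rightarrow> real \<Rightarrow> 'a \<Rightarrow> real) \<Rightarrow> bool" where
  "indep_brownian_motions M \<F> \<beta> \<longleftrightarrow>
      (\<forall>k. std_brownian_motion M \<F> (\<beta> k))
    \<and> prob_space.indep_vars M (\<lambda>_. \<Pi>\<^sub>M t\<in>{0..}. borel) (\<lambda>k \<omega>. \<lambda>t\<in>{0..}. \<beta> k t \<omega>) UNIV
    \<and> (\<forall>s t. 0 \<le> s \<longrightarrow> s < t \<longrightarrow>
          prob_space.indep_set M (sets (\<F> s))
            {(\<lambda>\<omega> k. \<beta> k t \<omega> - \<beta> k s \<omega>) -` B \<inter> space M | B. B \<in> sets (\<Pi>\<^sub>M k\<in>UNIV. borel)})"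

text \<open>\<open>W t = \<Sum>k. Q\<^sup>1\<^sup>/\<^sup>2 e\<^sub>k \<beta>\<^sub>k(t)\<close>, the series converging in \<open>L\<^sup>2(\<Omega>; U)\<close>, with \<open>W\<close> adapted and having
  almost surely continuous trajectories in \<open>U = L\<^sup>2(\<O>; \<real>)\<close>; \<open>R\<close> is \<open>Q\<^sup>1\<^sup>/\<^sup>2\<close>.  Indices start at 0.\<close>

definition wiener_series ::
    "pt set \<Rightarrow> 'a measure \<Rightarrow> (real \<Rightarrow> 'a measure) \<Rightarrow> ((pt \<Rightarrow> real) \<Rightarrow> (pt \<Rightarrow> real))
      \<Rightarrow> (nat \<Rightarrow> pt \<Rightarrow> real) \<Rightarrow> (nat \<Rightarrow> real \<Rightarrow> 'a \<Rightarrow> real) \<Rightarrow> (real \<Rightarrow> 'a \<Rightarrow> pt \<Rightarrow> real) \<Rightarrow> bool" where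
  "wiener_series \<O> M \<F> R e \<beta> W \<longleftrightarrow>
      (\<forall>t\<ge>0. random_elt (\<F> t) (L2 \<O>) (l2_norm \<O>) (W t))
    \<and> (AE \<omega> in M. \<forall>t\<ge>0. ((\<lambda>s. l2_norm \<O> (\<lambda>x. W s \<omega> x - W t \<omega> x)) \<longlongrightarrow> 0) (at t within {0..}))
    \<and> (\<forall>t\<ge>0. (\<lambda>n. \<integral>\<^sup>+\<omega>. ennreal ((l2_norm \<O> (\<lambda>x. W t \<omega> x - (\<Sum>k<n. R (e k) x * \<beta> k t \<omega>)))\<^sup>2) \<partial>M)
          \<longlonglongrightarrow> 0)"

section \<open>The exponential integrator\<close>

definition noise_coeff :: "real \<Rightarrow> real \<Rightarrow> (pt \<Rightarrow> real) \<Rightarrow> (pt \<Rightarrow> em)" where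
  "noise_coeff lam1 lam2 u = (\<lambda>x. ((\<chi> i. lam1 * u x), (\<chi> i. lam2 * u x)))"

primrec exp_integrator ::
    "(real \<Rightarrow> (pt \<Rightarrow> em) \<Rightarrow> (pt \<Rightarrow> em)) \<Rightarrow> ((pt \<Rightarrow> real) \<Rightarrow> (pt \<Rightarrow> em))
      \<Rightarrow> (real \<Rightarrow> 'a \<Rightarrow> pt \<Rightarrow> real) \<Rightarrow> real \<Rightarrow> ('a \<Rightarrow> pt \<Rightarrow> em) \<Rightarrow> nat \<Rightarrow> 'a \<Rightarrow> (pt \<Rightarrow> em)" where
  "exp_integrator S G W dt U0 0 = U0"
| "exp_integrator S G W dt U0 (Suc k) =
    (\<lambda>\<omega> x. S dt (exp_integrator S G W dt U0 k \<omega>) x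
          + S dt (G (\<lambda>y. W (real (Suc k) * dt) \<omega> y - W (real k * dt) \<omega> y)) x)"

end

theory Submission
  imports Defs
begin

text \<open>
  Pair the integrator with a fixed field \<open>g\<close> in \<open>L\<^sup>2\<close>. The group is unitary, so \<open>S(t)\<close> can be moved
  to \<open>g\<close> as \<open>S(-t)\<close>; what is left of each noise term is the pairing of an increment of \<open>W\<close> with
  a deterministic field, which has mean zero. Hence in the mean the scheme is the exact flow of the
  initial value: \<open>E\<langle>U\<^sub>k, g\<rangle> = E\<langle>S(k\<Delta>t) U\<^sub>0, g\<rangle>\<close> (\<open>exp_integrator_mean\<close>).

  For a test function \<open>\<phi>\<close> take \<open>g = (\<nabla>\<phi>, 0)\<close> or \<open>g = (0, \<nabla>\<phi>)\<close>, so that the pairing is minus the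
  divergence of the electric or magnetic field, tested with \<open>\<phi>\<close>. Since the curl of a gradient
  vanishes, \<open>\<langle>A v, g\<rangle> = 0\<close> for every \<open>v\<close> in the domain of the Maxwell operator \<open>A\<close>
  (\<open>maxwell_orthogonal_grad\<close>). So \<open>t \<mapsto> \<langle>S(t) u, g\<rangle>\<close> has derivative \<open>\<langle>A S(t) u, g\<rangle> = 0\<close> when \<open>u\<close>
  lies in the domain (\<open>group_conserves_annihilator\<close>). The initial value lies in the domain, whereas
  the later iterates need not, because the noise is merely in \<open>L\<^sup>2\<close>; this is why the mean is first
  carried back to \<open>U\<^sub>0\<close>. It follows that the mean divergence of every iterate, tested with \<open>\<phi>\<close>,
  is that of \<open>U\<^sub>0\<close>.

  The remaining work is to relate these scalar identities to expectations in \<open>H\<^sup>-\<^sup>1\<close>. A random element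
  of \<open>H\<^sup>-\<^sup>1\<close> with integrable norm has exactly one expectation, the functional that sends \<open>\<phi>\<close> to the
  integral of its values at \<open>\<phi>\<close> (\<open>Hm1_expectation_eq\<close>). The divergence is a bounded map from \<open>L\<^sup>2\<close> to
  \<open>H\<^sup>-\<^sup>1\<close>, so strong measurability and integrability of the iterates in \<open>L\<^sup>2\<close> suffice. Spaces consist
  of functions, not of classes of functions, and the operators are linear up to null sets only;
  measurability is therefore transported along Lipschitz maps (\<open>random_elt_Lipschitz_image\<close>).
\<close>

section \<open>Test functions and the curl of a gradient\<close>

lemma pd_has_real_derivative:
  fixes f :: "pt \<Rightarrow> real"
  assumes "\<And>x. f differentiable (at x)"
  shows "((\<lambda>t. f (x + t *\<^sub>R axis i 1)) has_real_derivative pd i f (x + t *\<^sub>R axis i 1)) (at t)"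
proof -
  define a :: pt where "a = axis i 1"
  have lin: "((\<lambda>t. x + t *\<^sub>R a) has_derivative (\<lambda>h. h *\<^sub>R a)) (at t)"
    by (auto intro!: derivative_eq_intros)
  have "(f has_derivative frechet_derivative f (at (x + t *\<^sub>R a))) (at (x + t *\<^sub>R a))"
    using assms frechet_derivative_works by blast
  from has_derivative_compose[OF lin this]
  have "((\<lambda>t. f (x + t *\<^sub>R a)) has_derivative
      (\<lambda>h. frechet_derivative f (at (x + t *\<^sub>R a)) (h *\<^sub>R a))) (at t)" .
  moreover have "frechet_derivative f (at (x + t *\<^sub>R a)) (h *\<^sub>R a) = pd i f (x + t *\<^sub>R a) * h" for h
    using linear_frechet_derivative[OF assms] by (simp add: pd_def a_def linear_cmul)
  ultimately show ?thesis
    by (simp add: has_field_derivative_def a_def)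
qed

text \<open>Two applications of the mean value theorem, one per variable, write the second difference of
  \<open>f\<close> over a small square as a value of the mixed derivative nearby; the second difference itself
  does not depend on the order of the two directions.\<close>

lemma second_difference_eq_mixed_pd:
  fixes f :: "pt \<Rightarrow> real"
  assumes f: "\<And>x. f differentiable (at x)" and pdf: "\<And>x. pd i f differentiable (at x)" and h: "h > 0"
  obtains y where "norm (y - x) \<le> 2 * h"
    and "f (x + h *\<^sub>R axis j 1 + h *\<^sub>R axis i 1) - f (x + h *\<^sub>R axis i 1)
         - f (x + h *\<^sub>R axis j 1) + f x = h * (h * pd j (pd i f) y)"
proof -
  define a b :: pt where ab: "a = axis i 1" "b = axis j 1"
  define g where "g t = f ((x + h *\<^sub>R b) + t *\<^sub>R a) - f (x + t *\<^sub>R a)" for t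
  define g' where "g' t = pd i f ((x + h *\<^sub>R b) + t *\<^sub>R a) - pd i f (x + t *\<^sub>R a)" for t
  have "(g has_real_derivative g' t) (at t)" for t
    unfolding g_def g'_def ab by (intro DERIV_diff pd_has_real_derivative f)
  from MVT2[OF h this] obtain z where z: "0 < z" "z < h" "g h - g 0 = h * g' z" by auto
  define k where "k s = pd i f ((x + z *\<^sub>R a) + s *\<^sub>R b)" for s
  define k' where "k' s = pd j (pd i f) ((x + z *\<^sub>R a) + s *\<^sub>R b)" for s
  have "(k has_real_derivative k' t) (at t)" for t
    unfolding k_def k'_def ab by (intro pd_has_real_derivative pdf)
  from MVT2[OF h this] obtain w where w: "0 < w" "w < h" "k h - k 0 = h * k' w" by auto
  have gk: "g' z = k h - k 0"
    by (simp add: g'_def k_def algebra_simps)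
  define y where "y = x + z *\<^sub>R a + w *\<^sub>R b"
  have "norm (y - x) \<le> norm (z *\<^sub>R a) + norm (w *\<^sub>R b)"
    unfolding y_def using norm_triangle_ineq[of "z *\<^sub>R a" "w *\<^sub>R b"] by simp
  also have "\<dots> \<le> 2 * h"
    using z w by (simp add: ab)
  finally have 1: "norm (y - x) \<le> 2 * h" .
  have 2: "f (x + h *\<^sub>R b + h *\<^sub>R a) - f (x + h *\<^sub>R a) - f (x + h *\<^sub>R b) + f x
      = h * (h * pd j (pd i f) y)"
    using z(3) w(3) gk by (simp add: g_def k'_def y_def)
  show ?thesis using that[OF 1] 2 unfolding ab by blast
qed

text \<open>Both mixed derivatives attain the same normalised second difference at points near \<open>x\<close>, so
  continuity forces them to agree at \<open>x\<close>.\<close>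

lemma mixed_pd_commute:
  fixes f :: "pt \<Rightarrow> real"
  assumes f: "\<And>x. f differentiable (at x)" and pdf: "\<And>i x. pd i f differentiable (at x)"
    and cont: "\<And>i j. continuous_on UNIV (pd j (pd i f))"
  shows "pd j (pd i f) x = pd i (pd j f) x"
proof (rule ccontr)
  define D1 D2 where D: "D1 = pd j (pd i f)" "D2 = pd i (pd j f)"
  assume "pd j (pd i f) x \<noteq> pd i (pd j f) x"
  define \<epsilon> where "\<epsilon> = \<bar>D1 x - D2 x\<bar> / 2"
  have e: "\<epsilon> > 0" using \<open>pd j (pd i f) x \<noteq> pd i (pd j f) x\<close> by (simp add: \<epsilon>_def D)
  have "isCont D1 x" "isCont D2 x"
    using cont by (auto simp: D continuous_on_eq_continuous_at)
  then have "\<exists>d>0. \<forall>y. norm (y - x) < d \<longrightarrow> \<bar>D1 y - D1 x\<bar> < \<epsilon>"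
      and "\<exists>d>0. \<forall>y. norm (y - x) < d \<longrightarrow> \<bar>D2 y - D2 x\<bar> < \<epsilon>"
    unfolding continuous_at_eps_delta dist_norm real_norm_def using e by blast+
  then obtain d1 d2 where d: "d1 > 0" "d2 > 0"
    and d1: "\<And>y. norm (y - x) < d1 \<Longrightarrow> \<bar>D1 y - D1 x\<bar> < \<epsilon>"
    and d2: "\<And>y. norm (y - x) < d2 \<Longrightarrow> \<bar>D2 y - D2 x\<bar> < \<epsilon>"
    by blast
  define h where "h = min d1 d2 / 3"
  have h: "h > 0" "2 * h < d1" "2 * h < d2" using d by (auto simp: h_def)
  obtain y where y: "norm (y - x) \<le> 2 * h"
      "f (x + h *\<^sub>R axis j 1 + h *\<^sub>R axis i 1) - f (x + h *\<^sub>R axis i 1)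
         - f (x + h *\<^sub>R axis j 1) + f x = h * (h * D1 y)"
    using second_difference_eq_mixed_pd[OF f pdf h(1)] unfolding D by blast
  obtain z where z: "norm (z - x) \<le> 2 * h"
      "f (x + h *\<^sub>R axis i 1 + h *\<^sub>R axis j 1) - f (x + h *\<^sub>R axis j 1)
         - f (x + h *\<^sub>R axis i 1) + f x = h * (h * D2 z)"
    using second_difference_eq_mixed_pd[OF f pdf h(1)] unfolding D by blast
  have "h * (h * D1 y) = h * (h * D2 z)"
    using y(2) z(2) by (simp add: algebra_simps)
  then have "D1 y = D2 z" using h by simp
  with d1[of y] d2[of z] y z h have "\<bar>D1 x - D2 x\<bar> < 2 * \<epsilon>" by linarith
  then show False by (simp add: \<epsilon>_def)
qed

lemma pd_zero [simp]: "pd i (\<lambda>x. 0) = (\<lambda>x. 0 :: 'b::real_normed_vector)"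
  by (simp add: pd_def fun_eq_iff frechet_derivative_const)

lemma smooth_on_zero: "smooth_on UNIV (\<lambda>x. 0 :: 'b::real_normed_vector)"
proof -
  have "Ck_on k UNIV (\<lambda>x. 0 :: 'b)" for k by (induction k) simp_all
  then show ?thesis by (simp add: smooth_on_def)
qed

lemma pd_lincomb:
  fixes f g :: "pt \<Rightarrow> 'b::real_normed_vector"
  assumes "\<And>x. f differentiable (at x)" "\<And>x. g differentiable (at x)"
  shows "pd i (\<lambda>x. a *\<^sub>R f x + b *\<^sub>R g x) = (\<lambda>x. a *\<^sub>R pd i f x + b *\<^sub>R pd i g x)"
proof
  fix x
  have "((\<lambda>x. a *\<^sub>R f x + b *\<^sub>R g x) has_derivative
      (\<lambda>h. a *\<^sub>R frechet_derivative f (at x) h + b *\<^sub>R frechet_derivative g (at x) h)) (at x)"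
    using assms frechet_derivative_works by (intro derivative_intros) blast+
  from frechet_derivative_at[OF this, symmetric]
  show "pd i (\<lambda>x. a *\<^sub>R f x + b *\<^sub>R g x) x = a *\<^sub>R pd i f x + b *\<^sub>R pd i g x"
    by (simp add: pd_def)
qed

lemma smooth_on_lincomb:
  fixes f g :: "pt \<Rightarrow> 'b::real_normed_vector"
  assumes "smooth_on UNIV f" "smooth_on UNIV g"
  shows "smooth_on UNIV (\<lambda>x. a *\<^sub>R f x + b *\<^sub>R g x)"
proof -
  have "Ck_on k UNIV (\<lambda>x. a *\<^sub>R f x + b *\<^sub>R g x)" if "Ck_on k UNIV f" "Ck_on k UNIV g" for k
    using that
    by (induction k arbitrary: f g) (auto simp: pd_lincomb intro!: continuous_intros)
  then show ?thesis using assms by (simp add: smooth_on_def)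
qed

lemma smooth_on_differentiable: "smooth_on UNIV f \<Longrightarrow> f differentiable (at x)"
  unfolding smooth_on_def by (drule spec[of _ "Suc 0"]) simp

lemma smooth_on_pd: "smooth_on UNIV f \<Longrightarrow> smooth_on UNIV (pd i f)"
  unfolding smooth_on_def
proof
  fix k assume "\<forall>k. Ck_on k UNIV f"
  then have "Ck_on (Suc k) UNIV f" by blast
  then show "Ck_on k UNIV (pd i f)" by simp
qed

lemma smooth_on_continuous: "smooth_on UNIV f \<Longrightarrow> continuous_on UNIV f"
  unfolding smooth_on_def by (drule spec[of _ 0]) simp

lemma has_derivative_vec_lambda:
  fixes f :: "3 \<Rightarrow> pt \<Rightarrow> real"
  assumes "\<And>j. (f j has_derivative f' j) (at x)"
  shows "((\<lambda>x. \<chi> j. f j x) has_derivative (\<lambda>h. \<chi> j. f' j h)) (at x)"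
  by (subst has_derivative_componentwise_within)
    (use assms in \<open>auto simp: Basis_vec_def inner_axis\<close>)

lemma smooth_on_vec_lambda:
  fixes f :: "3 \<Rightarrow> pt \<Rightarrow> real"
  assumes "\<And>j. smooth_on UNIV (f j)"
  shows "smooth_on UNIV (\<lambda>x. \<chi> j. f j x)"
    and "pd i (\<lambda>x. \<chi> j. f j x) = (\<lambda>x. \<chi> j. pd i (f j) x)"
proof -
  have der: "((\<lambda>x. \<chi> j. f j x) has_derivative (\<lambda>h. \<chi> j. frechet_derivative (f j) (at x) h)) (at x)"
    if "\<And>j. f j differentiable (at x)" for f :: "3 \<Rightarrow> pt \<Rightarrow> real" and x
    using that frechet_derivative_works by (intro has_derivative_vec_lambda) blast
  have pd: "pd i (\<lambda>x. \<chi> j. f j x) = (\<lambda>x. \<chi> j. pd i (f j) x)"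
    if "\<And>j x. f j differentiable (at x)" for f :: "3 \<Rightarrow> pt \<Rightarrow> real" and i
    using frechet_derivative_at[OF der, symmetric] that by (simp add: pd_def fun_eq_iff)
  have "Ck_on k UNIV (\<lambda>x. \<chi> j. f j x)" if "\<And>j. Ck_on k UNIV (f j)" for k
    using that
  proof (induction k arbitrary: f)
    case 0
    then show ?case by (auto intro!: continuous_intros)
  next
    case (Suc k)
    then have "(\<lambda>x. \<chi> j. f j x) differentiable (at x)" for x
      by (intro differentiableI[OF der]) simp
    with Suc show ?case by (simp add: pd)
  qed
  then show "smooth_on UNIV (\<lambda>x. \<chi> j. f j x)" using assms by (simp add: smooth_on_def)
  show "pd i (\<lambda>x. \<chi> j. f j x) = (\<lambda>x. \<chi> j. pd i (f j) x)"
    using assms by (intro pd smooth_on_differentiable)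
qed

lemma zero_in_test_fun: "(\<lambda>x. 0 :: 'b::real_normed_vector) \<in> test_fun \<O>"
  by (simp add: test_fun_def smooth_on_zero)

lemma test_fun_support_mono:
  assumes "smooth_on UNIV g" "closure {x. g x \<noteq> 0} \<subseteq> K" "compact K" "K \<subseteq> \<O>"
  shows "g \<in> test_fun \<O>"
  using assms compact_Int_closed[OF \<open>compact K\<close> closed_closure[of "{x. g x \<noteq> 0}"]]
  by (auto simp: test_fun_def Int_absorb1)

lemma test_fun_lincomb:
  assumes f: "f \<in> test_fun \<O>" and g: "g \<in> test_fun \<O>"
  shows "(\<lambda>x. a *\<^sub>R f x + b *\<^sub>R g x) \<in> test_fun \<O>"
proof (rule test_fun_support_mono)
  let ?K = "closure {x. f x \<noteq> 0} \<union> closure {x. g x \<noteq> 0}"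
  show "smooth_on UNIV (\<lambda>x. a *\<^sub>R f x + b *\<^sub>R g x)"
    using f g by (intro smooth_on_lincomb) (auto simp: test_fun_def)
  have "{x. a *\<^sub>R f x + b *\<^sub>R g x \<noteq> 0} \<subseteq> {x. f x \<noteq> 0} \<union> {x. g x \<noteq> 0}" by auto
  from closure_mono[OF this] show "closure {x. a *\<^sub>R f x + b *\<^sub>R g x \<noteq> 0} \<subseteq> ?K" by simp
  show "compact ?K" "?K \<subseteq> \<O>" using f g by (auto simp: test_fun_def)
qed

lemma grad_lincomb:
  assumes "f \<in> test_fun \<O>" "g \<in> test_fun \<O>"
  shows "grad (\<lambda>x. a * f x + b * g x) = (\<lambda>x. a *\<^sub>R grad f x + b *\<^sub>R grad g x)"
  using pd_lincomb[of f g _ a b] assms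
  by (auto simp: grad_def fun_eq_iff vec_eq_iff test_fun_def smooth_on_differentiable)

lemma pd_eq_0_outside_support:
  assumes x: "x \<notin> closure {x. f x \<noteq> 0}"
  shows "pd i f x = 0"
proof -
  define s where "s = - closure {x. f x \<noteq> 0}"
  have s: "open s" "x \<in> s" using x by (auto simp: s_def)
  have "0 = f y" if "y \<in> s" for y
  proof (rule ccontr)
    assume "0 \<noteq> f y"
    then have "y \<in> closure {x. f x \<noteq> 0}" by (intro subsetD[OF closure_subset]) simp
    with that show False by (simp add: s_def)
  qed
  from has_derivative_transform_within_open[OF has_derivative_const s this]
  have "(f has_derivative (\<lambda>h. 0)) (at x)" .
  from frechet_derivative_at[OF this, symmetric] show ?thesis by (simp add: pd_def)
qed

lemma grad_in_test_fun:
  assumes f: "f \<in> test_fun \<O>"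
  shows "grad f \<in> test_fun \<O>"
proof (rule test_fun_support_mono)
  show "smooth_on UNIV (grad f)"
    unfolding grad_def using f by (intro smooth_on_vec_lambda smooth_on_pd) (simp add: test_fun_def)
  have "{x. grad f x \<noteq> 0} \<subseteq> closure {x. f x \<noteq> 0}"
  proof
    fix x assume "x \<in> {x. grad f x \<noteq> 0}"
    then obtain i where "pd i f x \<noteq> 0" by (auto simp: grad_def vec_eq_iff)
    then show "x \<in> closure {x. f x \<noteq> 0}" using pd_eq_0_outside_support by blast
  qed
  then show "closure {x. grad f x \<noteq> 0} \<subseteq> closure {x. f x \<noteq> 0}"
    by (simp add: closure_minimal)
qed (use f in \<open>auto simp: test_fun_def\<close>)

lemma curl_grad_eq_0:
  assumes "smooth_on UNIV f"
  shows "curl (grad f) x = 0"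
proof -
  have "pd j (pd i f) x = pd i (pd j f) x" for i j
    by (intro mixed_pd_commute smooth_on_differentiable smooth_on_continuous smooth_on_pd assms)
  moreover have "pd i (grad f) = (\<lambda>x. \<chi> j. pd i (pd j f) x)" for i
    unfolding grad_def by (intro smooth_on_vec_lambda smooth_on_pd assms)
  ultimately show ?thesis
    by (simp add: curl_def vec_eq_iff forall_3)
qed

section \<open>Function spaces with a seminorm\<close>

text \<open>The spaces \<open>L\<^sup>2\<close> and \<open>H\<^sup>-\<^sup>1\<close> are both given as sets of functions with a seminorm (distinct
  functions in \<open>L\<^sup>2\<close> may have distance zero). The common theory of random elements is developed
  for this situation.\<close>

locale seminormed_functions =
  fixes C :: "('y \<Rightarrow> 'b::real_vector) set" and N :: "('y \<Rightarrow> 'b) \<Rightarrow> real"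
  assumes zero_mem: "(\<lambda>y. 0) \<in> C"
    and lincomb_mem: "u \<in> C \<Longrightarrow> v \<in> C \<Longrightarrow> (\<lambda>y. a *\<^sub>R u y + b *\<^sub>R v y) \<in> C"
    and norm_nonneg: "u \<in> C \<Longrightarrow> 0 \<le> N u"
    and norm_scale_le: "u \<in> C \<Longrightarrow> N (\<lambda>y. a *\<^sub>R u y) \<le> \<bar>a\<bar> * N u"
    and norm_triangle: "u \<in> C \<Longrightarrow> v \<in> C \<Longrightarrow> N (\<lambda>y. u y + v y) \<le> N u + N v"
begin

lemma add_mem: "u \<in> C \<Longrightarrow> v \<in> C \<Longrightarrow> (\<lambda>y. u y + v y) \<in> C"
  using lincomb_mem[of u v 1 1] by simp

lemma diff_mem: "u \<in> C \<Longrightarrow> v \<in> C \<Longrightarrow> (\<lambda>y. u y - v y) \<in> C"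
  using lincomb_mem[of u v 1 "-1"] by simp

lemma scale_mem: "u \<in> C \<Longrightarrow> (\<lambda>y. a *\<^sub>R u y) \<in> C"
  using lincomb_mem[of u u a 0] by simp

text \<open>The reverse inequality is \<open>norm_scale_le\<close> for the scalar \<open>inverse a\<close>.\<close>

lemma norm_scale:
  assumes u: "u \<in> C"
  shows "N (\<lambda>y. a *\<^sub>R u y) = \<bar>a\<bar> * N u"
proof (rule antisym)
  show "N (\<lambda>y. a *\<^sub>R u y) \<le> \<bar>a\<bar> * N u" by (rule norm_scale_le[OF u])
  show "\<bar>a\<bar> * N u \<le> N (\<lambda>y. a *\<^sub>R u y)"
  proof (cases "a = 0")
    case True
    then show ?thesis using norm_nonneg[OF scale_mem[OF u, of a]] by simp
  next
    case False
    then have "N u \<le> \<bar>inverse a\<bar> * N (\<lambda>y. a *\<^sub>R u y)"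
      using norm_scale_le[OF scale_mem[OF u, of a], of "inverse a"] by simp
    with False show ?thesis by (simp add: field_simps)
  qed
qed

lemma sum_mem: "(\<And>i. i \<in> I \<Longrightarrow> u i \<in> C) \<Longrightarrow> (\<lambda>y. \<Sum>i\<in>I. a i *\<^sub>R u i y) \<in> C"
proof (induction I rule: infinite_finite_induct)
  case (insert i I)
  then show ?case using lincomb_mem[of "u i" "\<lambda>y. \<Sum>i\<in>I. a i *\<^sub>R u i y" "a i" 1] by simp
qed (simp_all add: zero_mem)

lemma norm_zero: "N (\<lambda>y. 0) = 0"
  using norm_scale[OF zero_mem, of 0] by simp

lemma norm_diff_commute: "u \<in> C \<Longrightarrow> v \<in> C \<Longrightarrow> N (\<lambda>y. u y - v y) = N (\<lambda>y. v y - u y)"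
  using norm_scale[OF diff_mem, of u v "-1"] by simp

lemma norm_diff_triangle:
  assumes "u \<in> C" "v \<in> C" "w \<in> C"
  shows "N (\<lambda>y. u y - w y) \<le> N (\<lambda>y. u y - v y) + N (\<lambda>y. v y - w y)"
  using norm_triangle[OF diff_mem diff_mem, of u v v w] assms by simp

lemma norm_le_add_diff: "u \<in> C \<Longrightarrow> v \<in> C \<Longrightarrow> N u \<le> N v + N (\<lambda>y. u y - v y)"
  using norm_triangle[of v "\<lambda>y. u y - v y"] by (simp add: diff_mem)

lemma abs_norm_diff_le:
  assumes "u \<in> C" "v \<in> C"
  shows "\<bar>N u - N v\<bar> \<le> N (\<lambda>y. u y - v y)"
  using norm_le_add_diff[of u v] norm_le_add_diff[of v u] norm_diff_commute[of u v] assms by linarith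

lemma norm_sum_le:
  "(\<And>i. i \<in> I \<Longrightarrow> u i \<in> C) \<Longrightarrow> N (\<lambda>y. \<Sum>i\<in>I. a i *\<^sub>R u i y) \<le> (\<Sum>i\<in>I. \<bar>a i\<bar> * N (u i))"
proof (induction I rule: infinite_finite_induct)
  case (insert i I)
  then show ?case
    using norm_triangle[of "\<lambda>y. a i *\<^sub>R u i y" "\<lambda>y. \<Sum>i\<in>I. a i *\<^sub>R u i y"]
      norm_scale[of "u i" "a i"] sum_mem[of I u a] scale_mem[of "u i" "a i"]
    by simp
qed (simp_all add: norm_zero)

end

section \<open>The space \<open>L\<^sup>2\<close>\<close>

lemma L2_integrable_inner:
  assumes "f \<in> L2 \<O>" "g \<in> L2 \<O>"
  shows "integrable (lebesgue_on \<O>) (\<lambda>x. f x \<bullet> g x)"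
proof (rule Bochner_Integration.integrable_bound)
  show "integrable (lebesgue_on \<O>) (\<lambda>x. (norm (f x))\<^sup>2 + (norm (g x))\<^sup>2)"
    using assms by (auto simp: L2_def)
  show "(\<lambda>x. f x \<bullet> g x) \<in> borel_measurable (lebesgue_on \<O>)"
    using assms by (auto simp: L2_def)
  have "\<bar>a \<bullet> b\<bar> \<le> (norm a)\<^sup>2 + (norm b)\<^sup>2" for a b :: 'a
    using Cauchy_Schwarz_ineq2[of a b] sum_squares_bound[of "norm a" "norm b"]
    by (auto intro: order_trans)
  then show "AE x in lebesgue_on \<O>. norm (f x \<bullet> g x) \<le> norm ((norm (f x))\<^sup>2 + (norm (g x))\<^sup>2)"
    by simp
qed

lemma L2_I_integrable_inner:
  assumes "f \<in> borel_measurable (lebesgue_on \<O>)" "integrable (lebesgue_on \<O>) (\<lambda>x. f x \<bullet> f x)"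
  shows "f \<in> L2 \<O>"
  using assms by (simp add: L2_def power2_norm_eq_inner)

lemma L2_measurable [measurable_dest]: "f \<in> L2 \<O> \<Longrightarrow> f \<in> borel_measurable (lebesgue_on \<O>)"
  by (simp add: L2_def)

lemma L2_dominated:
  fixes f :: "pt \<Rightarrow> 'b::euclidean_space" and g :: "pt \<Rightarrow> 'c::euclidean_space"
  assumes g: "g \<in> L2 \<O>" and f: "f \<in> borel_measurable (lebesgue_on \<O>)"
    and le: "\<And>x. norm (f x) \<le> K * norm (g x)"
  shows "f \<in> L2 \<O>"
proof -
  have "integrable (lebesgue_on \<O>) (\<lambda>x. (norm (f x))\<^sup>2)"
  proof (rule Bochner_Integration.integrable_bound)
    show "integrable (lebesgue_on \<O>) (\<lambda>x. K\<^sup>2 * (norm (g x))\<^sup>2)"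
      using g by (simp add: L2_def)
    show "AE x in lebesgue_on \<O>. norm ((norm (f x))\<^sup>2) \<le> norm (K\<^sup>2 * (norm (g x))\<^sup>2)"
      using power_mono[OF le norm_ge_zero, of _ 2] by (simp add: power_mult_distrib)
  qed (use f in measurable)
  with f show ?thesis by (simp add: L2_def)
qed

lemma L2_lincomb:
  assumes f: "f \<in> L2 \<O>" and g: "g \<in> L2 \<O>"
  shows "(\<lambda>x. a *\<^sub>R f x + b *\<^sub>R g x) \<in> L2 \<O>"
proof (rule L2_I_integrable_inner)
  show "(\<lambda>x. a *\<^sub>R f x + b *\<^sub>R g x) \<in> borel_measurable (lebesgue_on \<O>)"
    using f g by measurable
  have "(\<lambda>x. (a *\<^sub>R f x + b *\<^sub>R g x) \<bullet> (a *\<^sub>R f x + b *\<^sub>R g x))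
      = (\<lambda>x. a\<^sup>2 * (f x \<bullet> f x) + 2 * a * b * (f x \<bullet> g x) + b\<^sup>2 * (g x \<bullet> g x))"
    by (auto simp: inner_simps inner_commute power2_eq_square algebra_simps)
  then show "integrable (lebesgue_on \<O>)
      (\<lambda>x. (a *\<^sub>R f x + b *\<^sub>R g x) \<bullet> (a *\<^sub>R f x + b *\<^sub>R g x))"
    using L2_integrable_inner[OF f f] L2_integrable_inner[OF f g] L2_integrable_inner[OF g g]
    by (simp only:) (intro Bochner_Integration.integrable_add integrable_mult_right)
qed

lemma l2_inner_commute: "l2_inner \<O> f g = l2_inner \<O> g f"
  by (simp add: l2_inner_def inner_commute)

lemma l2_inner_lincomb:
  assumes "f \<in> L2 \<O>" "g \<in> L2 \<O>" "h \<in> L2 \<O>"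
  shows "l2_inner \<O> (\<lambda>x. a *\<^sub>R f x + b *\<^sub>R g x) h = a * l2_inner \<O> f h + b * l2_inner \<O> g h"
  using L2_integrable_inner[OF assms(1,3)] L2_integrable_inner[OF assms(2,3)]
  by (simp add: l2_inner_def inner_simps)

lemma l2_inner_add:
  "f \<in> L2 \<O> \<Longrightarrow> g \<in> L2 \<O> \<Longrightarrow> h \<in> L2 \<O>
    \<Longrightarrow> l2_inner \<O> (\<lambda>x. f x + g x) h = l2_inner \<O> f h + l2_inner \<O> g h"
  using l2_inner_lincomb[of f \<O> g h 1 1] by simp

lemma l2_inner_diff:
  "f \<in> L2 \<O> \<Longrightarrow> g \<in> L2 \<O> \<Longrightarrow> h \<in> L2 \<O>
    \<Longrightarrow> l2_inner \<O> (\<lambda>x. f x - g x) h = l2_inner \<O> f h - l2_inner \<O> g h"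
  using l2_inner_lincomb[of f \<O> g h 1 "-1"] by simp

lemma l2_inner_nonneg: "0 \<le> l2_inner \<O> f f"
  by (simp add: l2_inner_def)

lemma l2_norm_nonneg: "0 \<le> l2_norm \<O> f"
  by (simp add: l2_norm_def l2_inner_nonneg)

lemma l2_norm_sq: "(l2_norm \<O> f)\<^sup>2 = l2_inner \<O> f f"
  by (simp add: l2_norm_def l2_inner_nonneg)

lemma l2_norm_sq_lincomb:
  assumes "f \<in> L2 \<O>" "g \<in> L2 \<O>"
  shows "(l2_norm \<O> (\<lambda>x. a *\<^sub>R f x + b *\<^sub>R g x))\<^sup>2
    = a\<^sup>2 * (l2_norm \<O> f)\<^sup>2 + 2 * a * b * l2_inner \<O> f g + b\<^sup>2 * (l2_norm \<O> g)\<^sup>2"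
proof -
  let ?h = "\<lambda>x. a *\<^sub>R f x + b *\<^sub>R g x"
  have "l2_inner \<O> ?h ?h = a * l2_inner \<O> ?h f + b * l2_inner \<O> ?h g"
    using l2_inner_lincomb[OF assms L2_lincomb[OF assms]] by (simp add: l2_inner_commute)
  then show ?thesis
    using assms unfolding l2_norm_sq
    by (simp add: l2_inner_lincomb l2_inner_commute[of \<O> g f] algebra_simps power2_eq_square)
qed

text \<open>The quadratic form \<open>(s, t) \<mapsto> \<parallel>s f + t g\<parallel>\<^sup>2\<close> is nonnegative, so its discriminant is not positive.\<close>

lemma l2_Cauchy_Schwarz:
  assumes "f \<in> L2 \<O>" "g \<in> L2 \<O>"
  shows "\<bar>l2_inner \<O> f g\<bar> \<le> l2_norm \<O> f * l2_norm \<O> g"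
proof -
  define a b c where abc: "a = (l2_norm \<O> f)\<^sup>2" "b = l2_inner \<O> f g" "c = (l2_norm \<O> g)\<^sup>2"
  have q: "0 \<le> s\<^sup>2 * a + 2 * s * t * b + t\<^sup>2 * c" for s t
    unfolding abc l2_norm_sq_lincomb[OF assms, symmetric] by simp
  have "b\<^sup>2 \<le> a * c"
  proof (cases "c = 0")
    case True
    have "b = 0"
    proof (rule ccontr)
      assume "b \<noteq> 0"
      \<comment> \<open>For \<open>s = 1\<close> the form is now affine in \<open>t\<close>; at this \<open>t\<close> it has the value \<open>-1\<close>.\<close>
      with q[of 1 "- (a + 1) / (2 * b)"] True show False by (simp add: field_simps)
    qed
    then show ?thesis by (simp add: True)
  next
    case False
    then have "c > 0" by (simp add: abc)
    moreover have "0 \<le> c * (a * c - b\<^sup>2)"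
      using q[of c "- b"] by (simp add: power2_eq_square algebra_simps)
    ultimately show ?thesis by (simp add: zero_le_mult_iff)
  qed
  then have "\<bar>b\<bar>\<^sup>2 \<le> (l2_norm \<O> f * l2_norm \<O> g)\<^sup>2"
    by (simp add: abc power_mult_distrib)
  then show ?thesis
    unfolding abc by (rule power2_le_imp_le) (simp add: l2_norm_nonneg)
qed

lemma l2_norm_scale: "l2_norm \<O> (\<lambda>x. a *\<^sub>R f x) = \<bar>a\<bar> * l2_norm \<O> f"
  by (simp add: l2_norm_def l2_inner_def real_sqrt_mult mult.assoc[symmetric])

interpretation L2: seminormed_functions "L2 \<O> :: (pt \<Rightarrow> 'b::euclidean_space) set" "l2_norm \<O>"
  for \<O>
proof
  fix u v :: "pt \<Rightarrow> 'b" and a b :: real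
  show zero: "(\<lambda>x. 0 :: 'b) \<in> L2 \<O>" by (simp add: L2_def)
  show "0 \<le> l2_norm \<O> u" by (rule l2_norm_nonneg)
  assume u: "u \<in> L2 \<O>"
  show "l2_norm \<O> (\<lambda>y. a *\<^sub>R u y) \<le> \<bar>a\<bar> * l2_norm \<O> u"
    by (simp add: l2_norm_scale)
  assume v: "v \<in> L2 \<O>"
  show "(\<lambda>y. a *\<^sub>R u y + b *\<^sub>R v y) \<in> L2 \<O>" by (rule L2_lincomb[OF u v])
  have "(l2_norm \<O> (\<lambda>y. u y + v y))\<^sup>2 \<le> (l2_norm \<O> u + l2_norm \<O> v)\<^sup>2"
    using l2_norm_sq_lincomb[OF u v, of 1 1] l2_Cauchy_Schwarz[OF u v] by (simp add: power2_sum)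
  then show "l2_norm \<O> (\<lambda>y. u y + v y) \<le> l2_norm \<O> u + l2_norm \<O> v"
    by (rule power2_le_imp_le) (simp add: l2_norm_nonneg)
qed

lemma l2_inner_cong_ae:
  assumes "f \<in> L2 \<O>" "f' \<in> L2 \<O>" "g \<in> L2 \<O>" "ae_eq \<O> f f'"
  shows "l2_inner \<O> f g = l2_inner \<O> f' g"
  unfolding l2_inner_def
proof (rule integral_cong_AE)
  show "AE x in lebesgue_on \<O>. f x \<bullet> g x = f' x \<bullet> g x"
    using assms(4) unfolding ae_eq_def by eventually_elim simp
qed (use assms(1-3) in measurable)

lemma l2_norm_cong_ae:
  assumes "f \<in> L2 \<O>" "f' \<in> L2 \<O>" "ae_eq \<O> f f'"
  shows "l2_norm \<O> f = l2_norm \<O> f'"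
  using l2_inner_cong_ae[OF assms(1,2,1,3)] l2_inner_cong_ae[OF assms(1,2,2,3)]
  by (simp add: l2_norm_def l2_inner_commute)

lemma test_fun_in_L2:
  fixes g :: "pt \<Rightarrow> 'b::euclidean_space"
  assumes g: "g \<in> test_fun \<O>" and \<O>: "open \<O>"
  shows "g \<in> L2 \<O>"
proof -
  define K where "K = closure {x. g x \<noteq> 0}"
  have K: "compact K" using g by (simp add: test_fun_def K_def)
  have cont: "continuous_on A g" for A
    using g smooth_on_continuous continuous_on_subset by (fastforce simp: test_fun_def)
  have ind: "indicator K x *\<^sub>R (norm (g x))\<^sup>2 = (norm (g x))\<^sup>2" for x
    using closure_subset[of "{x. g x \<noteq> 0}"] by (auto simp: K_def indicator_def)
  have "integrable lborel (\<lambda>x. (norm (g x))\<^sup>2)"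
    using borel_integrable_compact[OF K continuous_on_power[OF continuous_on_norm[OF cont]], of 2]
    unfolding ind .
  then have "integrable lebesgue (\<lambda>x. (norm (g x))\<^sup>2)"
    by (simp add: integrable_completion borel_measurable_integrable)
  then have "integrable lebesgue (\<lambda>x. indicator \<O> x *\<^sub>R (norm (g x))\<^sup>2)"
    using \<O> by (intro integrable_mult_indicator) auto
  then have "integrable (lebesgue_on \<O>) (\<lambda>x. (norm (g x))\<^sup>2)"
    using \<O> by (subst integrable_restrict_space) auto
  moreover have "g \<in> borel_measurable (lebesgue_on \<O>)"
    using \<O> cont by (intro continuous_imp_measurable_on_sets_lebesgue) auto
  ultimately show ?thesis by (simp add: L2_def)
qed

section \<open>The Maxwell group\<close>

lemma groupD:
  assumes "unitary_C0_group \<O> S"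
  shows group_mem: "u \<in> L2 \<O> \<Longrightarrow> S t u \<in> L2 \<O>"
    and group_inner: "u \<in> L2 \<O> \<Longrightarrow> v \<in> L2 \<O> \<Longrightarrow> l2_inner \<O> (S t u) (S t v) = l2_inner \<O> u v"
    and group_zero: "u \<in> L2 \<O> \<Longrightarrow> ae_eq \<O> (S 0 u) u"
    and group_add: "u \<in> L2 \<O> \<Longrightarrow> ae_eq \<O> (S (s + t) u) (S s (S t u))"
    and group_lincomb: "u \<in> L2 \<O> \<Longrightarrow> v \<in> L2 \<O> \<Longrightarrow>
      ae_eq \<O> (S t (\<lambda>x. a *\<^sub>R u x + b *\<^sub>R v x)) (\<lambda>x. a *\<^sub>R S t u x + b *\<^sub>R S t v x)"
  using assms by (simp_all add: unitary_C0_group_def bounded_op_def)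

lemma group_norm:
  assumes "unitary_C0_group \<O> S" "u \<in> L2 \<O>"
  shows "l2_norm \<O> (S t u) = l2_norm \<O> u"
  using group_inner[OF assms(1,2,2)] by (simp add: l2_norm_def)

text \<open>\<open>S t\<close> commutes with subtraction up to null sets only, which the seminorm does not see.\<close>

lemma group_norm_diff:
  assumes S: "unitary_C0_group \<O> S" and u: "u \<in> L2 \<O>" and v: "v \<in> L2 \<O>"
  shows "l2_norm \<O> (\<lambda>x. S t u x - S t v x) = l2_norm \<O> (\<lambda>x. u x - v x)"
proof -
  have "ae_eq \<O> (S t (\<lambda>x. u x - v x)) (\<lambda>x. S t u x - S t v x)"
    using group_lincomb[OF S u v, of t 1 "-1"] by simp
  then have "l2_norm \<O> (S t (\<lambda>x. u x - v x)) = l2_norm \<O> (\<lambda>x. S t u x - S t v x)"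
    by (intro l2_norm_cong_ae group_mem[OF S] L2.diff_mem u v)
  then show ?thesis using group_norm[OF S L2.diff_mem[OF u v]] by simp
qed

text \<open>Apply the isometry \<open>S t\<close> to both arguments on the right and cancel it against \<open>S (-t)\<close>.\<close>

lemma group_adjoint:
  assumes S: "unitary_C0_group \<O> S" and u: "u \<in> L2 \<O>" and v: "v \<in> L2 \<O>"
  shows "l2_inner \<O> (S t u) v = l2_inner \<O> u (S (-t) v)"
proof -
  have mem: "S r w \<in> L2 \<O>" if "w \<in> L2 \<O>" for r w using group_mem[OF S that] .
  have "l2_inner \<O> u (S (-t) v) = l2_inner \<O> (S t (S (-t) v)) (S t u)"
    using group_inner[OF S u mem[OF v]] by (simp add: l2_inner_commute)
  also have "\<dots> = l2_inner \<O> (S (t + (-t)) v) (S t u)"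
    using group_add[OF S v] by (intro l2_inner_cong_ae[symmetric] mem u v)
  also have "\<dots> = l2_inner \<O> (S 0 v) (S t u)"
    by simp
  also have "\<dots> = l2_inner \<O> v (S t u)"
    using group_zero[OF S v] by (intro l2_inner_cong_ae mem u v)
  finally show ?thesis by (simp add: l2_inner_commute)
qed

lemma weak_curl_is_weak_curl:
  assumes "v \<in> Hcurl \<O>"
  shows "is_weak_curl \<O> v (weak_curl \<O> v)"
proof -
  have "\<exists>w. is_weak_curl \<O> v w" using assms by (simp add: Hcurl_def)
  then show ?thesis unfolding weak_curl_def by (rule someI_ex)
qed

lemma L2_em_I:
  assumes "f \<in> L2 \<O>" "g \<in> L2 \<O>"
  shows "(\<lambda>x. (f x, g x)) \<in> L2 \<O>"
proof (rule L2_I_integrable_inner)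
  show "(\<lambda>x. (f x, g x)) \<in> borel_measurable (lebesgue_on \<O>)"
    using assms by (intro borel_measurable_Pair L2_measurable)
  show "integrable (lebesgue_on \<O>) (\<lambda>x. (f x, g x) \<bullet> (f x, g x))"
    using assms by (simp add: L2_integrable_inner)
qed

lemma L2_em_D:
  fixes u :: "pt \<Rightarrow> em"
  assumes "u \<in> L2 \<O>"
  shows "Efld u \<in> L2 \<O>" "Hfld u \<in> L2 \<O>"
proof -
  have [measurable]: "(\<lambda>x. fst (u x)) \<in> borel_measurable (lebesgue_on \<O>)"
      "(\<lambda>x. snd (u x)) \<in> borel_measurable (lebesgue_on \<O>)"
    using L2_measurable[OF assms]
    by (auto intro!: borel_measurable_continuous_on[where g=u] continuous_intros)
  have "norm (fst p) \<le> 1 * norm p" "norm (snd p) \<le> 1 * norm p" for p :: em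
    using norm_fst_le[of "fst p" "snd p"] norm_snd_le[of "snd p" "fst p"] by simp_all
  from this[of "u _"] show "Efld u \<in> L2 \<O>" "Hfld u \<in> L2 \<O>"
    unfolding Efld_def[abs_def] Hfld_def[abs_def] by (auto intro: L2_dominated[OF assms, where K=1])
qed

lemma maxwell_dom_subset_L2: "u \<in> maxwell_dom \<O> \<Longrightarrow> u \<in> L2 \<O>"
  using L2_em_I[of "Efld u" \<O> "Hfld u"]
  by (simp add: maxwell_dom_def H0curl_def Hcurl_def Efld_def Hfld_def)

lemma maxwell_in_L2:
  assumes "u \<in> maxwell_dom \<O>"
  shows "maxwell \<O> u \<in> L2 \<O>"
proof -
  have "weak_curl \<O> (Efld u) \<in> L2 \<O>" "weak_curl \<O> (Hfld u) \<in> L2 \<O>"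
    using assms weak_curl_is_weak_curl by (auto simp: maxwell_dom_def H0curl_def is_weak_curl_def)
  then show ?thesis
    using L2.scale_mem[of "weak_curl \<O> (Efld u)" \<O> "-1"] by (simp add: maxwell_def L2_em_I)
qed

text \<open>\<open>S t\<close> is an isometry that commutes with the difference quotients of orbits. So the quotients at
  \<open>S t u\<close> are exactly as close to \<open>S t (A u)\<close> as those at \<open>u\<close> are to \<open>A u\<close>, and the description of the
  generator yields both claims at once.\<close>

lemma group_preserves_maxwell_dom:
  assumes S: "unitary_C0_group \<O> S" and gen: "generated_by_maxwell \<O> S" and u: "u \<in> maxwell_dom \<O>"
  shows "S t u \<in> maxwell_dom \<O>" "ae_eq \<O> (S t (maxwell \<O> u)) (maxwell \<O> (S t u))"
proof -
  have uL: "u \<in> L2 \<O>" and wL: "maxwell \<O> u \<in> L2 \<O>"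
    using u by (rule maxwell_dom_subset_L2, rule maxwell_in_L2)
  have mem: "S r w \<in> L2 \<O>" if "w \<in> L2 \<O>" for r w using group_mem[OF S that] .
  have quot: "(\<lambda>x. (f x - g x) /\<^sub>R h) \<in> L2 \<O>" if "f \<in> L2 \<O>" "g \<in> L2 \<O>" for f g :: "pt \<Rightarrow> em" and h
    using L2.scale_mem[OF L2.diff_mem[OF that]] .
  have eq: "l2_norm \<O> (\<lambda>x. (S h (S t u) x - S t u x) /\<^sub>R h - S t (maxwell \<O> u) x)
      = l2_norm \<O> (\<lambda>x. (S h u x - u x) /\<^sub>R h - maxwell \<O> u x)" for h
  proof -
    define d where "d = (\<lambda>x. (S h u x - u x) /\<^sub>R h)"
    have dL: "d \<in> L2 \<O>" unfolding d_def by (intro quot mem uL)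
    have "ae_eq \<O> (S t d) (\<lambda>x. inverse h *\<^sub>R S t (S h u) x + (- inverse h) *\<^sub>R S t u x)"
      using group_lincomb[OF S mem[OF uL] uL, of t "inverse h" h "- inverse h"]
      by (simp add: d_def scaleR_diff_right)
    moreover have "ae_eq \<O> (S (h + t) u) (S h (S t u))" "ae_eq \<O> (S (h + t) u) (S t (S h u))"
      using group_add[OF S uL, of h t] group_add[OF S uL, of t h] by (simp_all add: add.commute)
    ultimately have "ae_eq \<O> (\<lambda>x. (S h (S t u) x - S t u x) /\<^sub>R h - S t (maxwell \<O> u) x)
        (\<lambda>x. S t d x - S t (maxwell \<O> u) x)"
      unfolding ae_eq_def by eventually_elim (simp add: scaleR_diff_right)
    then have "l2_norm \<O> (\<lambda>x. (S h (S t u) x - S t u x) /\<^sub>R h - S t (maxwell \<O> u) x)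
        = l2_norm \<O> (\<lambda>x. S t d x - S t (maxwell \<O> u) x)"
      by (intro l2_norm_cong_ae L2.diff_mem quot mem uL wL dL)
    also have "\<dots> = l2_norm \<O> (\<lambda>x. d x - maxwell \<O> u x)"
      by (rule group_norm_diff[OF S dL wL])
    finally show ?thesis by (simp add: d_def)
  qed
  have "((\<lambda>h. l2_norm \<O> (\<lambda>x. (S h u x - u x) /\<^sub>R h - maxwell \<O> u x)) \<longlongrightarrow> 0) (at 0)"
    using gen u uL wL by (auto simp: generated_by_maxwell_def ae_eq_def)
  then have "((\<lambda>h. l2_norm \<O> (\<lambda>x. (S h (S t u) x - S t u x) /\<^sub>R h - S t (maxwell \<O> u) x)) \<longlongrightarrow> 0) (at 0)"
    unfolding eq .
  then show "S t u \<in> maxwell_dom \<O>" "ae_eq \<O> (S t (maxwell \<O> u)) (maxwell \<O> (S t u))"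
    using gen mem[OF uL] mem[OF wL] by (auto simp: generated_by_maxwell_def)
qed

text \<open>A functional that annihilates the range of the generator is a conserved quantity: along the
  orbit of a point of the domain it has derivative zero.\<close>

lemma group_conserves_annihilator:
  assumes S: "unitary_C0_group \<O> S" and gen: "generated_by_maxwell \<O> S"
    and g: "g \<in> L2 \<O>" and ann: "\<And>v. v \<in> maxwell_dom \<O> \<Longrightarrow> l2_inner \<O> (maxwell \<O> v) g = 0"
    and u: "u \<in> maxwell_dom \<O>"
  shows "l2_inner \<O> (S t u) g = l2_inner \<O> u g"
proof -
  have uL: "u \<in> L2 \<O>" by (rule maxwell_dom_subset_L2[OF u])
  have mem: "S r w \<in> L2 \<O>" if "w \<in> L2 \<O>" for r w using group_mem[OF S that] .
  define f where "f t = l2_inner \<O> (S t u) g" for t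
  have der: "(f has_real_derivative 0) (at t)" for t
  proof -
    define v where "v = S t u"
    have vD: "v \<in> maxwell_dom \<O>" unfolding v_def by (rule group_preserves_maxwell_dom[OF S gen u])
    have vL: "v \<in> L2 \<O>" and wL: "maxwell \<O> v \<in> L2 \<O>"
      using vD by (rule maxwell_dom_subset_L2, rule maxwell_in_L2)
    define r where "r h = (\<lambda>x. (S h v x - v x) /\<^sub>R h - maxwell \<O> v x)" for h
    have rL: "r h \<in> L2 \<O>" for h
      unfolding r_def by (intro L2.diff_mem L2.scale_mem mem vL wL)
    have quot: "(f (t + h) - f t) / h = l2_inner \<O> (r h) g" for h
    proof -
      have "f (t + h) = l2_inner \<O> (S h v) g"
        unfolding f_def v_def using group_add[OF S uL, of h t]
        by (intro l2_inner_cong_ae mem uL g) (simp add: add.commute)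
      moreover have "l2_inner \<O> (r h) g = l2_inner \<O> (\<lambda>x. (S h v x - v x) /\<^sub>R h) g"
        unfolding r_def
        by (subst l2_inner_diff) (auto intro!: L2.diff_mem L2.scale_mem mem vL wL g simp: ann[OF vD])
      moreover have "l2_inner \<O> (\<lambda>x. (S h v x - v x) /\<^sub>R h) g
          = (l2_inner \<O> (S h v) g - l2_inner \<O> v g) / h"
        using l2_inner_lincomb[OF mem[OF vL] vL g, of "inverse h" h "- inverse h"]
        by (simp add: scaleR_diff_right divide_inverse algebra_simps)
      ultimately show ?thesis by (simp add: f_def v_def)
    qed
    have "((\<lambda>h. l2_norm \<O> (r h)) \<longlongrightarrow> 0) (at 0)"
      using gen vD vL wL unfolding r_def by (auto simp: generated_by_maxwell_def ae_eq_def)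
    then have "((\<lambda>h. l2_norm \<O> (r h) * l2_norm \<O> g) \<longlongrightarrow> 0) (at 0)"
      by (rule tendsto_mult_left_zero)
    then have "((\<lambda>h. l2_inner \<O> (r h) g) \<longlongrightarrow> 0) (at 0)"
      by (rule Lim_null_comparison[rotated])
        (intro always_eventually allI, simp add: l2_Cauchy_Schwarz[OF rL g])
    then show ?thesis by (simp add: DERIV_def quot)
  qed
  then have "f t = f 0" by (intro DERIV_isconst_all) blast
  also have "f 0 = l2_inner \<O> u g"
    unfolding f_def using group_zero[OF S uL] by (intro l2_inner_cong_ae mem uL g)
  finally show ?thesis by (simp add: f_def)
qed

lemma l2_inner_em:
  fixes u v :: "pt \<Rightarrow> em"
  assumes "u \<in> L2 \<O>" "v \<in> L2 \<O>"
  shows "l2_inner \<O> u v = l2_inner \<O> (Efld u) (Efld v) + l2_inner \<O> (Hfld u) (Hfld v)"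
  using L2_integrable_inner[OF L2_em_D(1) L2_em_D(1), OF assms]
    L2_integrable_inner[OF L2_em_D(2) L2_em_D(2), OF assms]
  by (simp add: l2_inner_def inner_prod_def Efld_def Hfld_def)

text \<open>The gradient of a test function is an admissible test field in the definition of the weak curl,
  and its curl vanishes.\<close>

lemma weak_curl_orthogonal_grad:
  assumes v: "v \<in> Hcurl \<O>" and \<phi>: "\<phi> \<in> test_fun \<O>"
  shows "l2_inner \<O> (weak_curl \<O> v) (grad \<phi>) = 0"
proof -
  have "l2_inner \<O> (weak_curl \<O> v) (grad \<phi>) = l2_inner \<O> v (curl (grad \<phi>))"
    using weak_curl_is_weak_curl[OF v] grad_in_test_fun[OF \<phi>] by (simp add: is_weak_curl_def)
  also have "\<dots> = 0"
    using \<phi> by (simp add: l2_inner_def curl_grad_eq_0 test_fun_def)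
  finally show ?thesis .
qed

text \<open>The fields in the range of the Maxwell operator have divergence zero in the sense of
  distributions. These are the annihilators to which \<open>group_conserves_annihilator\<close> will be applied.\<close>

lemma maxwell_orthogonal_grad:
  assumes "u \<in> maxwell_dom \<O>" and "\<phi> \<in> test_fun \<O>"
  shows "l2_inner \<O> (maxwell \<O> u) (\<lambda>x. (grad \<phi> x, 0)) = 0"
    and "l2_inner \<O> (maxwell \<O> u) (\<lambda>x. (0, grad \<phi> x)) = 0"
  using weak_curl_orthogonal_grad[of "Hfld u" \<O> \<phi>] weak_curl_orthogonal_grad[of "Efld u" \<O> \<phi>] assms
  by (simp_all add: l2_inner_def maxwell_def maxwell_dom_def H0curl_def)

section \<open>Random elements and their approximation in mean\<close>

lemma random_elt_mem: "random_elt M C N X \<Longrightarrow> \<omega> \<in> space M \<Longrightarrow> X \<omega> \<in> C"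
  by (simp add: random_elt_def)

lemma random_eltI:
  assumes "\<And>\<omega>. \<omega> \<in> space M \<Longrightarrow> X \<omega> \<in> C"
    and "\<And>n. simple_function M (s n)" "\<And>n \<omega>. \<omega> \<in> space M \<Longrightarrow> s n \<omega> \<in> C"
    and "\<And>\<omega>. \<omega> \<in> space M \<Longrightarrow> (\<lambda>n. N (\<lambda>y. X \<omega> y - s n \<omega> y)) \<longlonglongrightarrow> 0"
  shows "random_elt M C N X"
  unfolding random_elt_def using assms by (intro conjI exI[of _ s]) simp_all

lemma random_eltE:
  assumes "random_elt M C N X"
  obtains s where "\<And>n. simple_function M (s n)" "\<And>n \<omega>. \<omega> \<in> space M \<Longrightarrow> s n \<omega> \<in> C"
    and "\<And>\<omega>. \<omega> \<in> space M \<Longrightarrow> (\<lambda>n. N (\<lambda>y. X \<omega> y - s n \<omega> y)) \<longlonglongrightarrow> 0"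
  using assms unfolding random_elt_def by blast

lemma random_elt_subalgebra:
  assumes "random_elt F C N X" "subalgebra M F"
  shows "random_elt M C N X"
proof -
  have [simp]: "space F = space M" using assms(2) by (simp add: subalgebra_def)
  obtain s where s: "\<And>n. simple_function F (s n)" "\<And>n \<omega>. \<omega> \<in> space F \<Longrightarrow> s n \<omega> \<in> C"
      "\<And>\<omega>. \<omega> \<in> space F \<Longrightarrow> (\<lambda>n. N (\<lambda>y. X \<omega> y - s n \<omega> y)) \<longlonglongrightarrow> 0"
    using random_eltE[OF assms(1)] by blast
  have "simple_function M (s n)" for n
    using assms(2) by (intro simple_function_subalgebra[OF s(1)]) (simp_all add: subalgebra_def)
  then show ?thesis
    using s random_elt_mem[OF assms(1)] by (intro random_eltI[where s=s]) simp_all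
qed

text \<open>This applies to the group, to the noise coefficient, to the two components of the field and to
  the divergence. Transporting the approximating simple functions uses distances only, so that
  linearity of \<open>T\<close> up to null sets causes no trouble.\<close>

lemma random_elt_Lipschitz_image:
  assumes X: "random_elt M C N X"
    and T: "\<And>u. u \<in> C \<Longrightarrow> T u \<in> C'"
    and le: "\<And>u v. u \<in> C \<Longrightarrow> v \<in> C \<Longrightarrow> N' (\<lambda>y. T u y - T v y) \<le> K * N (\<lambda>y. u y - v y)"
    and nonneg: "\<And>u v. u \<in> C \<Longrightarrow> v \<in> C \<Longrightarrow> 0 \<le> N' (\<lambda>y. T u y - T v y)"
  shows "random_elt M C' N' (\<lambda>\<omega>. T (X \<omega>))"
proof -
  obtain s where s: "\<And>n. simple_function M (s n)" "\<And>n \<omega>. \<omega> \<in> space M \<Longrightarrow> s n \<omega> \<in> C"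
      "\<And>\<omega>. \<omega> \<in> space M \<Longrightarrow> (\<lambda>n. N (\<lambda>y. X \<omega> y - s n \<omega> y)) \<longlonglongrightarrow> 0"
    using random_eltE[OF X] by blast
  have "(\<lambda>n. N' (\<lambda>y. T (X \<omega>) y - T (s n \<omega>) y)) \<longlonglongrightarrow> 0" if \<omega>: "\<omega> \<in> space M" for \<omega>
  proof (rule tendsto_sandwich[OF _ _ tendsto_const])
    show "(\<lambda>n. K * N (\<lambda>y. X \<omega> y - s n \<omega> y)) \<longlonglongrightarrow> 0"
      using s(3)[OF \<omega>] by (rule tendsto_mult_right_zero)
  qed (use random_elt_mem[OF X \<omega>] s(2)[OF \<omega>] in \<open>auto intro!: always_eventually le nonneg\<close>)
  moreover have "simple_function M (\<lambda>\<omega>. T (s n \<omega>))" for n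
    using s(1) by (rule simple_function_compose1)
  ultimately show ?thesis
    using s(2) T random_elt_mem[OF X] by (intro random_eltI[where s="\<lambda>n \<omega>. T (s n \<omega>)"]) simp_all
qed

context seminormed_functions
begin

lemma random_elt_add:
  assumes X: "random_elt M C N X" and Y: "random_elt M C N Y"
  shows "random_elt M C N (\<lambda>\<omega> y. X \<omega> y + Y \<omega> y)"
proof -
  obtain s where s: "\<And>n. simple_function M (s n)" "\<And>n \<omega>. \<omega> \<in> space M \<Longrightarrow> s n \<omega> \<in> C"
      "\<And>\<omega>. \<omega> \<in> space M \<Longrightarrow> (\<lambda>n. N (\<lambda>y. X \<omega> y - s n \<omega> y)) \<longlonglongrightarrow> 0"
    using random_eltE[OF X] by blast
  obtain r where r: "\<And>n. simple_function M (r n)" "\<And>n \<omega>. \<omega> \<in> space M \<Longrightarrow> r n \<omega> \<in> C"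
      "\<And>\<omega>. \<omega> \<in> space M \<Longrightarrow> (\<lambda>n. N (\<lambda>y. Y \<omega> y - r n \<omega> y)) \<longlonglongrightarrow> 0"
    using random_eltE[OF Y] by blast
  have "(\<lambda>n. N (\<lambda>y. (X \<omega> y + Y \<omega> y) - (s n \<omega> y + r n \<omega> y))) \<longlonglongrightarrow> 0" if \<omega>: "\<omega> \<in> space M" for \<omega>
  proof (rule tendsto_sandwich[OF _ _ tendsto_const])
    show "(\<lambda>n. N (\<lambda>y. X \<omega> y - s n \<omega> y) + N (\<lambda>y. Y \<omega> y - r n \<omega> y)) \<longlonglongrightarrow> 0"
      using tendsto_add[OF s(3)[OF \<omega>] r(3)[OF \<omega>]] by simp
    note mem = random_elt_mem[OF X \<omega>] random_elt_mem[OF Y \<omega>] s(2)[OF \<omega>] r(2)[OF \<omega>]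
    show "\<forall>\<^sub>F n in sequentially. 0 \<le> N (\<lambda>y. (X \<omega> y + Y \<omega> y) - (s n \<omega> y + r n \<omega> y))"
      using mem by (intro always_eventually allI norm_nonneg diff_mem add_mem)
    show "\<forall>\<^sub>F n in sequentially. N (\<lambda>y. (X \<omega> y + Y \<omega> y) - (s n \<omega> y + r n \<omega> y))
        \<le> N (\<lambda>y. X \<omega> y - s n \<omega> y) + N (\<lambda>y. Y \<omega> y - r n \<omega> y)"
    proof (intro always_eventually allI)
      fix n
      show "N (\<lambda>y. (X \<omega> y + Y \<omega> y) - (s n \<omega> y + r n \<omega> y))
        \<le> N (\<lambda>y. X \<omega> y - s n \<omega> y) + N (\<lambda>y. Y \<omega> y - r n \<omega> y)"
        using norm_triangle[of "\<lambda>y. X \<omega> y - s n \<omega> y" "\<lambda>y. Y \<omega> y - r n \<omega> y"] mem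
        by (simp add: diff_mem algebra_simps)
    qed
  qed
  moreover have "simple_function M (\<lambda>\<omega> y. s n \<omega> y + r n \<omega> y)" for n
    using simple_function_compose2[OF s(1) r(1), of "\<lambda>a b y. a y + b y"] .
  moreover have "(\<lambda>y. X \<omega> y + Y \<omega> y) \<in> C" "(\<lambda>y. s n \<omega> y + r n \<omega> y) \<in> C" if "\<omega> \<in> space M" for \<omega> n
    using that by (auto intro!: add_mem s(2) r(2) random_elt_mem[OF X] random_elt_mem[OF Y])
  ultimately show ?thesis
    by (intro random_eltI[where s="\<lambda>n \<omega> y. s n \<omega> y + r n \<omega> y"])
qed

lemma random_elt_scale:
  assumes "random_elt M C N X"
  shows "random_elt M C N (\<lambda>\<omega> y. a *\<^sub>R X \<omega> y)"
proof (rule random_elt_Lipschitz_image[OF assms, where T="\<lambda>u y. a *\<^sub>R u y" and K="\<bar>a\<bar>"])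
  fix u v assume uv: "u \<in> C" "v \<in> C"
  then show "N (\<lambda>y. a *\<^sub>R u y - a *\<^sub>R v y) \<le> \<bar>a\<bar> * N (\<lambda>y. u y - v y)"
    using norm_scale_le[OF diff_mem, of u v a] by (simp add: scaleR_diff_right)
  show "0 \<le> N (\<lambda>y. a *\<^sub>R u y - a *\<^sub>R v y)"
    using uv by (intro norm_nonneg diff_mem scale_mem)
qed (rule scale_mem)

text \<open>Such functionals are measurable as pointwise limits along the approximating simple functions.
  Norms and pairings with a fixed element are of this kind.\<close>

lemma random_elt_functional_measurable:
  fixes f :: "('y \<Rightarrow> 'b) \<Rightarrow> real"
  assumes X: "random_elt M C N X"
    and f: "\<And>u v. u \<in> C \<Longrightarrow> v \<in> C \<Longrightarrow> \<bar>f u - f v\<bar> \<le> K * N (\<lambda>y. u y - v y)"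
  shows "(\<lambda>\<omega>. f (X \<omega>)) \<in> borel_measurable M"
proof -
  obtain s where s: "\<And>n. simple_function M (s n)" "\<And>n \<omega>. \<omega> \<in> space M \<Longrightarrow> s n \<omega> \<in> C"
      "\<And>\<omega>. \<omega> \<in> space M \<Longrightarrow> (\<lambda>n. N (\<lambda>y. X \<omega> y - s n \<omega> y)) \<longlonglongrightarrow> 0"
    using random_eltE[OF X] by blast
  show ?thesis
  proof (rule borel_measurable_LIMSEQ_real)
    show "(\<lambda>\<omega>. f (s n \<omega>)) \<in> borel_measurable M" for n
      using simple_function_compose1[OF s(1)] by (rule borel_measurable_simple_function)
    fix \<omega> assume \<omega>: "\<omega> \<in> space M"
    have "(\<lambda>n. K * N (\<lambda>y. X \<omega> y - s n \<omega> y)) \<longlonglongrightarrow> 0"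
      using s(3)[OF \<omega>] by (rule tendsto_mult_right_zero)
    then have "(\<lambda>n. f (X \<omega>) - f (s n \<omega>)) \<longlonglongrightarrow> 0"
      using f[OF random_elt_mem[OF X \<omega>] s(2)[OF \<omega>]]
      by (elim Lim_null_comparison[rotated]) simp
    from tendsto_diff[OF tendsto_const this, of "f (X \<omega>)"]
    show "(\<lambda>n. f (s n \<omega>)) \<longlonglongrightarrow> f (X \<omega>)" by simp
  qed
qed

text \<open>In contrast to \<open>random_elt_functional_measurable\<close> the functional applied to \<open>X \<omega>\<close> depends on
  \<open>\<omega>\<close> here. The error of an approximation by simple functions is of this form.\<close>

lemma random_elt_distance_measurable:
  assumes X: "random_elt M C N X" and r: "simple_function M r" "\<And>\<omega>. \<omega> \<in> space M \<Longrightarrow> r \<omega> \<in> C"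
  shows "(\<lambda>\<omega>. N (\<lambda>y. X \<omega> y - r \<omega> y)) \<in> borel_measurable M"
proof -
  obtain s where s: "\<And>n. simple_function M (s n)" "\<And>n \<omega>. \<omega> \<in> space M \<Longrightarrow> s n \<omega> \<in> C"
      "\<And>\<omega>. \<omega> \<in> space M \<Longrightarrow> (\<lambda>n. N (\<lambda>y. X \<omega> y - s n \<omega> y)) \<longlonglongrightarrow> 0"
    using random_eltE[OF X] by blast
  show ?thesis
  proof (rule borel_measurable_LIMSEQ_real)
    show "(\<lambda>\<omega>. N (\<lambda>y. s n \<omega> y - r \<omega> y)) \<in> borel_measurable M" for n
      using simple_function_compose2[OF s(1) r(1), of "\<lambda>a b. N (\<lambda>y. a y - b y)"]
      by (rule borel_measurable_simple_function)
    fix \<omega> assume \<omega>: "\<omega> \<in> space M"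
    note mem = random_elt_mem[OF X \<omega>] s(2)[OF \<omega>] r(2)[OF \<omega>]
    have "\<bar>N (\<lambda>y. s n \<omega> y - r \<omega> y) - N (\<lambda>y. X \<omega> y - r \<omega> y)\<bar> \<le> N (\<lambda>y. X \<omega> y - s n \<omega> y)" for n
      using abs_norm_diff_le[of "\<lambda>y. X \<omega> y - r \<omega> y" "\<lambda>y. s n \<omega> y - r \<omega> y"] mem
      by (simp add: diff_mem abs_minus_commute)
    then have "(\<lambda>n. N (\<lambda>y. s n \<omega> y - r \<omega> y) - N (\<lambda>y. X \<omega> y - r \<omega> y)) \<longlonglongrightarrow> 0"
      by (intro Lim_null_comparison[OF _ s(3)[OF \<omega>]] always_eventually) simp
    then show "(\<lambda>n. N (\<lambda>y. s n \<omega> y - r \<omega> y)) \<longlonglongrightarrow> N (\<lambda>y. X \<omega> y - r \<omega> y)"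
      by (rule LIM_zero_cancel)
  qed
qed

lemma random_elt_norm_measurable:
  assumes "random_elt M C N X"
  shows "(\<lambda>\<omega>. N (X \<omega>)) \<in> borel_measurable M"
  using assms by (rule random_elt_functional_measurable[where K=1]) (simp add: abs_norm_diff_le)

text \<open>Pointwise approximation becomes approximation in mean after truncation: a value of the
  approximating function is replaced by \<open>0\<close> where its norm exceeds twice that of \<open>X\<close>. The errors are
  then dominated by \<open>3 N (X \<omega>)\<close>.\<close>

lemma random_elt_L1_approximation:
  assumes X: "random_elt M C N X" and int: "integrable M (\<lambda>\<omega>. N (X \<omega>))"
  obtains s where "\<And>n. simple_function M (s n)" "\<And>n \<omega>. \<omega> \<in> space M \<Longrightarrow> s n \<omega> \<in> C"
    and "\<And>n. integrable M (\<lambda>\<omega>. N (\<lambda>y. X \<omega> y - s n \<omega> y))"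
    and "(\<lambda>n. \<integral>\<omega>. N (\<lambda>y. X \<omega> y - s n \<omega> y) \<partial>M) \<longlonglongrightarrow> 0"
proof -
  obtain r where r: "\<And>n. simple_function M (r n)" "\<And>n \<omega>. \<omega> \<in> space M \<Longrightarrow> r n \<omega> \<in> C"
      "\<And>\<omega>. \<omega> \<in> space M \<Longrightarrow> (\<lambda>n. N (\<lambda>y. X \<omega> y - r n \<omega> y)) \<longlonglongrightarrow> 0"
    using random_eltE[OF X] by blast
  have [measurable]: "(\<lambda>\<omega>. N (X \<omega>)) \<in> borel_measurable M"
    by (rule random_elt_norm_measurable[OF X])
  have [measurable]: "(\<lambda>\<omega>. N (r n \<omega>)) \<in> borel_measurable M" for n
    using simple_function_compose1[OF r(1)] by (rule borel_measurable_simple_function)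
  define s where "s n \<omega> = (if N (r n \<omega>) \<le> 2 * N (X \<omega>) then r n \<omega> else (\<lambda>y. 0))" for n \<omega>
  have s: "simple_function M (s n)" for n
    unfolding s_def by (intro simple_function_If r(1) simple_function_const) measurable
  have sC: "s n \<omega> \<in> C" if "\<omega> \<in> space M" for n \<omega>
    using that r(2) zero_mem by (simp add: s_def)
  have [measurable]: "(\<lambda>\<omega>. N (\<lambda>y. X \<omega> y - s n \<omega> y)) \<in> borel_measurable M" for n
    by (rule random_elt_distance_measurable[OF X s sC])
  have nonneg: "0 \<le> N (\<lambda>y. X \<omega> y - s n \<omega> y)" if "\<omega> \<in> space M" for n \<omega>
    using that X by (intro norm_nonneg diff_mem sC random_elt_mem)
  \<comment> \<open>Where the truncation is active, \<open>N (r n \<omega>) > 2 N (X \<omega>)\<close>, so \<open>0\<close> is the better approximation.\<close>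
  have le: "N (\<lambda>y. X \<omega> y - s n \<omega> y) \<le> N (\<lambda>y. X \<omega> y - r n \<omega> y)" if \<omega>: "\<omega> \<in> space M" for n \<omega>
    using norm_le_add_diff[OF r(2)[OF \<omega>] random_elt_mem[OF X \<omega>], of n]
      norm_diff_commute[OF r(2)[OF \<omega>] random_elt_mem[OF X \<omega>], of n]
    by (auto simp: s_def)
  have bound: "N (\<lambda>y. X \<omega> y - s n \<omega> y) \<le> 3 * N (X \<omega>)" if \<omega>: "\<omega> \<in> space M" for n \<omega>
  proof -
    have "N (\<lambda>y. X \<omega> y - s n \<omega> y) \<le> N (X \<omega>) + N (s n \<omega>)"
      using norm_diff_triangle[OF random_elt_mem[OF X \<omega>] zero_mem sC[OF \<omega>], of n]
        norm_diff_commute[OF zero_mem sC[OF \<omega>], of n] by simp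
    also have "N (s n \<omega>) \<le> 2 * N (X \<omega>)"
      using norm_nonneg[OF random_elt_mem[OF X \<omega>]] by (auto simp: s_def norm_zero)
    finally show ?thesis by simp
  qed
  have lim: "(\<lambda>n. N (\<lambda>y. X \<omega> y - s n \<omega> y)) \<longlonglongrightarrow> 0" if \<omega>: "\<omega> \<in> space M" for \<omega>
    by (rule tendsto_sandwich[OF _ _ tendsto_const r(3)[OF \<omega>]])
      (use \<omega> in \<open>auto intro!: always_eventually le nonneg\<close>)
  have dom: "integrable M (\<lambda>\<omega>. 3 * N (X \<omega>))" using int by simp
  have ints: "integrable M (\<lambda>\<omega>. N (\<lambda>y. X \<omega> y - s n \<omega> y))" for n
    by (rule Bochner_Integration.integrable_bound[OF dom])
      (use nonneg bound in \<open>auto intro!: AE_I2 order_trans[OF _ abs_ge_self]\<close>)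
  have "(\<lambda>n. \<integral>\<omega>. N (\<lambda>y. X \<omega> y - s n \<omega> y) \<partial>M) \<longlonglongrightarrow> (\<integral>\<omega>. 0 \<partial>M)"
    by (rule integral_dominated_convergence[OF _ _ dom])
      (use nonneg bound lim in \<open>auto intro!: AE_I2\<close>)
  then show ?thesis using that[OF s sC ints] by simp
qed

lemma simple_expectation_mem:
  "(\<And>\<omega>. \<omega> \<in> space M \<Longrightarrow> s \<omega> \<in> C) \<Longrightarrow> simple_expectation M s \<in> C"
  unfolding simple_expectation_def by (rule sum_mem) auto

end

lemma simple_expectation_apply:
  fixes s :: "'a \<Rightarrow> 'y \<Rightarrow> real"
  assumes M: "finite_measure M" and s: "simple_function M s"
  shows "integrable M (\<lambda>\<omega>. s \<omega> y)" "simple_expectation M s y = (\<integral>\<omega>. s \<omega> y \<partial>M)"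
proof -
  interpret finite_measure M by (rule M)
  have fin: "finite (s ` space M)" using s by (rule simple_functionD)
  have sets: "s -` {c} \<inter> space M \<in> sets M" for c using s by (rule simple_functionD)
  have eq: "s \<omega> y = (\<Sum>c\<in>s ` space M. indicator (s -` {c} \<inter> space M) \<omega> * c y)"
    if \<omega>: "\<omega> \<in> space M" for \<omega>
  proof -
    have "(\<Sum>c\<in>s ` space M. indicator (s -` {c} \<inter> space M) \<omega> * c y)
        = (\<Sum>c\<in>s ` space M. if c = s \<omega> then c y else 0)"
      using \<omega> by (intro sum.cong) auto
    then show ?thesis using fin \<omega> by simp
  qed
  have ints: "integrable M (\<lambda>\<omega>. indicator (s -` {c} \<inter> space M) \<omega> * c y)" for c
    using sets by (intro integrable_mult_left integrable_real_indicator) (auto simp: emeasure_eq_measure)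
  have "integrable M (\<lambda>\<omega>. \<Sum>c\<in>s ` space M. indicator (s -` {c} \<inter> space M) \<omega> * c y)"
    by (intro Bochner_Integration.integrable_sum ints)
  then show "integrable M (\<lambda>\<omega>. s \<omega> y)"
    by (rule Bochner_Integration.integrable_cong[THEN iffD1, rotated -1]) (simp_all add: eq)
  have "(\<integral>\<omega>. s \<omega> y \<partial>M) = (\<integral>\<omega>. (\<Sum>c\<in>s ` space M. indicator (s -` {c} \<inter> space M) \<omega> * c y) \<partial>M)"
    by (intro Bochner_Integration.integral_cong refl eq)
  also have "\<dots> = (\<Sum>c\<in>s ` space M. \<integral>\<omega>. indicator (s -` {c} \<inter> space M) \<omega> * c y \<partial>M)"
    by (rule Bochner_Integration.integral_sum) (rule ints)
  also have "\<dots> = simple_expectation M s y"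
    by (simp add: simple_expectation_def Int_assoc)
  finally show "simple_expectation M s y = (\<integral>\<omega>. s \<omega> y \<partial>M)" by simp
qed

section \<open>Expectations in \<open>H\<^sup>-\<^sup>1\<close>\<close>

lemma h1_norm_nonneg: "0 \<le> h1_norm \<O> \<phi>"
  by (simp add: h1_norm_def)

lemma h1_norm_scale:
  assumes "\<phi> \<in> test_fun \<O>"
  shows "h1_norm \<O> (\<lambda>x. a * \<phi> x) = \<bar>a\<bar> * h1_norm \<O> \<phi>"
proof -
  have "grad (\<lambda>x. a * \<phi> x) = (\<lambda>x. a *\<^sub>R grad \<phi> x)"
    using grad_lincomb[OF assms assms, of a 0] by simp
  then have "(l2_norm \<O> (\<lambda>x. a * \<phi> x))\<^sup>2 + (l2_norm \<O> (grad (\<lambda>x. a * \<phi> x)))\<^sup>2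
      = a\<^sup>2 * ((l2_norm \<O> \<phi>)\<^sup>2 + (l2_norm \<O> (grad \<phi>))\<^sup>2)"
    using l2_norm_scale[of \<O> a \<phi>] l2_norm_scale[of \<O> a "grad \<phi>"]
    by (simp add: power_mult_distrib algebra_simps)
  then show ?thesis by (simp add: h1_norm_def real_sqrt_mult)
qed

lemma l2_norm_grad_le_h1_norm: "l2_norm \<O> (grad \<phi>) \<le> h1_norm \<O> \<phi>"
  unfolding h1_norm_def by (rule real_le_rsqrt) simp

lemma zero_in_h1_ball: "(\<lambda>x. 0) \<in> {\<phi> \<in> test_fun \<O>. h1_norm \<O> \<phi> \<le> 1}"
  using h1_norm_scale[OF zero_in_test_fun, of \<O> 0] by (simp add: zero_in_test_fun)

lemma Hm1_norm_bdd_above: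
  assumes "T \<in> Hm1 \<O>"
  shows "bdd_above ((\<lambda>\<phi>. \<bar>T \<phi>\<bar>) ` {\<phi> \<in> test_fun \<O>. h1_norm \<O> \<phi> \<le> 1})"
proof -
  obtain C where C: "\<And>\<phi>. \<phi> \<in> test_fun \<O> \<Longrightarrow> \<bar>T \<phi>\<bar> \<le> C * h1_norm \<O> \<phi>"
    using assms unfolding Hm1_def by blast
  have "\<bar>T \<phi>\<bar> \<le> \<bar>C\<bar>" if "\<phi> \<in> test_fun \<O>" "h1_norm \<O> \<phi> \<le> 1" for \<phi>
  proof -
    have "C * h1_norm \<O> \<phi> \<le> \<bar>C\<bar> * 1"
      using that(2) h1_norm_nonneg by (intro mult_mono) auto
    with C[OF that(1)] show ?thesis by simp
  qed
  then show ?thesis by (intro bdd_aboveI2[where M="\<bar>C\<bar>"]) auto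
qed

lemma Hm1_norm_nonneg:
  assumes "T \<in> Hm1 \<O>"
  shows "0 \<le> Hm1_norm \<O> T"
  unfolding Hm1_norm_def
  by (rule cSUP_upper2[OF Hm1_norm_bdd_above[OF assms] zero_in_h1_ball]) simp

text \<open>The supremum defining the norm runs over a unit ball, onto whose boundary \<open>\<phi>\<close> is scaled. If the
  \<open>H\<^sup>1\<close> norm of \<open>\<phi>\<close> is zero, then \<open>T \<phi> = 0\<close> because \<open>T\<close> is bounded.\<close>

lemma Hm1_apply_le:
  assumes T: "T \<in> Hm1 \<O>" and \<phi>: "\<phi> \<in> test_fun \<O>"
  shows "\<bar>T \<phi>\<bar> \<le> Hm1_norm \<O> T * h1_norm \<O> \<phi>"
proof (cases "h1_norm \<O> \<phi> = 0")
  case True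
  moreover obtain C where "\<bar>T \<phi>\<bar> \<le> C * h1_norm \<O> \<phi>"
    using T \<phi> unfolding Hm1_def by blast
  ultimately show ?thesis by simp
next
  case False
  define h where "h = h1_norm \<O> \<phi>"
  have h: "h > 0" using False h1_norm_nonneg[of \<O> \<phi>] by (simp add: h_def)
  define \<psi> where "\<psi> = (\<lambda>x. inverse h * \<phi> x)"
  have \<psi>: "\<psi> \<in> test_fun \<O>"
    using test_fun_lincomb[OF \<phi> \<phi>, of "inverse h" 0] by (simp add: \<psi>_def)
  moreover have "h1_norm \<O> \<psi> = 1"
    using h1_norm_scale[OF \<phi>, of "inverse h"] h by (simp add: \<psi>_def h_def[symmetric])
  ultimately have "\<bar>T \<psi>\<bar> \<le> Hm1_norm \<O> T"
    unfolding Hm1_norm_def by (intro cSUP_upper Hm1_norm_bdd_above[OF T]) simp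
  moreover have "T (\<lambda>x. inverse h * \<phi> x + 0 * \<phi> x) = inverse h * T \<phi> + 0 * T \<phi>"
    using T \<phi> unfolding Hm1_def by blast
  then have "T \<psi> = inverse h * T \<phi>" by (simp add: \<psi>_def)
  ultimately show ?thesis
    using h by (simp add: abs_mult h_def[symmetric] field_simps)
qed

lemma Hm1_norm_le:
  assumes "\<And>\<phi>. \<phi> \<in> test_fun \<O> \<Longrightarrow> \<bar>T \<phi>\<bar> \<le> K * h1_norm \<O> \<phi>" and K: "0 \<le> K"
  shows "Hm1_norm \<O> T \<le> K"
  unfolding Hm1_norm_def
proof (rule cSUP_least)
  fix \<phi> assume \<phi>: "\<phi> \<in> {\<phi> \<in> test_fun \<O>. h1_norm \<O> \<phi> \<le> 1}"
  then have "K * h1_norm \<O> \<phi> \<le> K * 1" using K by (intro mult_left_mono) auto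
  with assms(1)[of \<phi>] \<phi> show "\<bar>T \<phi>\<bar> \<le> K" by simp
qed (use zero_in_h1_ball in blast)

lemma Hm1I:
  assumes "\<And>\<phi>. \<phi> \<notin> test_fun \<O> \<Longrightarrow> T \<phi> = 0"
    and "\<And>\<phi> \<psi> a b. \<phi> \<in> test_fun \<O> \<Longrightarrow> \<psi> \<in> test_fun \<O>
      \<Longrightarrow> T (\<lambda>x. a * \<phi> x + b * \<psi> x) = a * T \<phi> + b * T \<psi>"
    and "\<And>\<phi>. \<phi> \<in> test_fun \<O> \<Longrightarrow> \<bar>T \<phi>\<bar> \<le> K * h1_norm \<O> \<phi>"
  shows "T \<in> Hm1 \<O>"
  using assms unfolding Hm1_def by blast

lemma Hm1_zero_outside: "T \<in> Hm1 \<O> \<Longrightarrow> \<phi> \<notin> test_fun \<O> \<Longrightarrow> T \<phi> = 0"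
  by (simp add: Hm1_def)

lemma Hm1_linear:
  "T \<in> Hm1 \<O> \<Longrightarrow> \<phi> \<in> test_fun \<O> \<Longrightarrow> \<psi> \<in> test_fun \<O>
    \<Longrightarrow> T (\<lambda>x. a * \<phi> x + b * \<psi> x) = a * T \<phi> + b * T \<psi>"
  unfolding Hm1_def by blast

interpretation Hm1: seminormed_functions "Hm1 \<O>" "Hm1_norm \<O>" for \<O>
proof
  fix T R :: distr and a b :: real
  show "(\<lambda>\<phi>. 0) \<in> Hm1 \<O>" by (rule Hm1I[where K=0]) auto
  assume T: "T \<in> Hm1 \<O>"
  show "0 \<le> Hm1_norm \<O> T" by (rule Hm1_norm_nonneg[OF T])
  show "Hm1_norm \<O> (\<lambda>\<phi>. a *\<^sub>R T \<phi>) \<le> \<bar>a\<bar> * Hm1_norm \<O> T"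
    using Hm1_apply_le[OF T] Hm1_norm_nonneg[OF T]
    by (intro Hm1_norm_le) (auto simp: abs_mult mult.assoc intro!: mult_left_mono)
  assume R: "R \<in> Hm1 \<O>"
  have le: "\<bar>a * T \<phi> + b * R \<phi>\<bar> \<le> (\<bar>a\<bar> * Hm1_norm \<O> T + \<bar>b\<bar> * Hm1_norm \<O> R) * h1_norm \<O> \<phi>"
    if "\<phi> \<in> test_fun \<O>" for \<phi> a b
  proof -
    have "\<bar>a * T \<phi> + b * R \<phi>\<bar> \<le> \<bar>a\<bar> * \<bar>T \<phi>\<bar> + \<bar>b\<bar> * \<bar>R \<phi>\<bar>"
      using abs_triangle_ineq[of "a * T \<phi>" "b * R \<phi>"] by (simp add: abs_mult)
    also have "\<dots> \<le> \<bar>a\<bar> * (Hm1_norm \<O> T * h1_norm \<O> \<phi>) + \<bar>b\<bar> * (Hm1_norm \<O> R * h1_norm \<O> \<phi>)"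
      using Hm1_apply_le[OF T that] Hm1_apply_le[OF R that] by (intro add_mono mult_left_mono) auto
    finally show ?thesis by (simp add: algebra_simps)
  qed
  show "(\<lambda>\<phi>. a *\<^sub>R T \<phi> + b *\<^sub>R R \<phi>) \<in> Hm1 \<O>"
  proof (rule Hm1I)
    fix \<phi> :: "pt \<Rightarrow> real" assume "\<phi> \<in> test_fun \<O>"
    from le[OF this] show "\<bar>a *\<^sub>R T \<phi> + b *\<^sub>R R \<phi>\<bar>
        \<le> (\<bar>a\<bar> * Hm1_norm \<O> T + \<bar>b\<bar> * Hm1_norm \<O> R) * h1_norm \<O> \<phi>" by simp
  qed (use T R in \<open>auto simp: Hm1_zero_outside Hm1_linear algebra_simps\<close>)
  show "Hm1_norm \<O> (\<lambda>\<phi>. T \<phi> + R \<phi>) \<le> Hm1_norm \<O> T + Hm1_norm \<O> R"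
    using le[of _ 1 1] Hm1_norm_nonneg[OF T] Hm1_norm_nonneg[OF R] by (intro Hm1_norm_le) auto
qed

lemma Hm1_eval_measurable:
  assumes X: "random_elt M (Hm1 \<O>) (Hm1_norm \<O>) X" and \<phi>: "\<phi> \<in> test_fun \<O>"
  shows "(\<lambda>\<omega>. X \<omega> \<phi>) \<in> borel_measurable M"
  using X
proof (rule Hm1.random_elt_functional_measurable)
  fix T R assume "T \<in> Hm1 \<O>" "R \<in> Hm1 \<O>"
  then show "\<bar>T \<phi> - R \<phi>\<bar> \<le> h1_norm \<O> \<phi> * Hm1_norm \<O> (\<lambda>y. T y - R y)"
    using Hm1_apply_le[OF Hm1.diff_mem \<phi>] by (simp add: mult.commute)
qed

text \<open>Evaluation at a test function is continuous on \<open>H\<^sup>-\<^sup>1\<close>, hence commutes with the expectation.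
  So the expectation, if it exists, is determined by scalar integrals.\<close>

lemma has_expectation_Hm1_apply:
  assumes M: "finite_measure M"
    and E: "has_expectation M (Hm1 \<O>) (Hm1_norm \<O>) X m" and \<phi>: "\<phi> \<in> test_fun \<O>"
  shows "m \<phi> = (\<integral>\<omega>. X \<omega> \<phi> \<partial>M)"
proof -
  have X: "random_elt M (Hm1 \<O>) (Hm1_norm \<O>) X" and m: "m \<in> Hm1 \<O>"
    using E by (simp_all add: has_expectation_def)
  obtain s where s: "\<And>n. simple_function M (s n)" "\<And>n \<omega>. \<omega> \<in> space M \<Longrightarrow> s n \<omega> \<in> Hm1 \<O>"
      "(\<lambda>n. \<integral>\<^sup>+\<omega>. ennreal (Hm1_norm \<O> (\<lambda>y. X \<omega> y - s n \<omega> y)) \<partial>M) \<longlonglongrightarrow> 0"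
      "(\<lambda>n. Hm1_norm \<O> (\<lambda>y. simple_expectation M (s n) y - m y)) \<longlonglongrightarrow> 0"
    using E unfolding has_expectation_def by blast
  have [measurable]: "(\<lambda>\<omega>. Hm1_norm \<O> (\<lambda>y. X \<omega> y - s n \<omega> y)) \<in> borel_measurable M" for n
    by (rule Hm1.random_elt_distance_measurable[OF X s(1,2)])
  have [measurable]: "(\<lambda>\<omega>. X \<omega> \<phi>) \<in> borel_measurable M"
    by (rule Hm1_eval_measurable[OF X \<phi>])
  have int_s: "integrable M (\<lambda>\<omega>. s n \<omega> \<phi>)" for n
    by (rule simple_expectation_apply(1)[OF M s(1)])
  have le: "(\<integral>\<^sup>+\<omega>. norm (s n \<omega> \<phi> - X \<omega> \<phi>) \<partial>M)
      \<le> ennreal (h1_norm \<O> \<phi>) * (\<integral>\<^sup>+\<omega>. ennreal (Hm1_norm \<O> (\<lambda>y. X \<omega> y - s n \<omega> y)) \<partial>M)" for n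
  proof -
    have "(\<integral>\<^sup>+\<omega>. norm (s n \<omega> \<phi> - X \<omega> \<phi>) \<partial>M)
        \<le> (\<integral>\<^sup>+\<omega>. ennreal (h1_norm \<O> \<phi>) * ennreal (Hm1_norm \<O> (\<lambda>y. X \<omega> y - s n \<omega> y)) \<partial>M)"
    proof (rule nn_integral_mono)
      fix \<omega> assume \<omega>: "\<omega> \<in> space M"
      show "ennreal (norm (s n \<omega> \<phi> - X \<omega> \<phi>))
          \<le> ennreal (h1_norm \<O> \<phi>) * ennreal (Hm1_norm \<O> (\<lambda>y. X \<omega> y - s n \<omega> y))"
        using Hm1_apply_le[OF Hm1.diff_mem[OF random_elt_mem[OF X \<omega>] s(2)[OF \<omega>]] \<phi>, of n]
        by (simp add: ennreal_mult'[symmetric] h1_norm_nonneg abs_minus_commute mult.commute ennreal_leI)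
    qed
    then show ?thesis by (simp add: nn_integral_cmult)
  qed
  have L1: "(\<lambda>n. \<integral>\<^sup>+\<omega>. norm (s n \<omega> \<phi> - X \<omega> \<phi>) \<partial>M) \<longlonglongrightarrow> 0"
  proof (rule tendsto_sandwich[OF _ _ tendsto_const])
    show "(\<lambda>n. ennreal (h1_norm \<O> \<phi>) * (\<integral>\<^sup>+\<omega>. ennreal (Hm1_norm \<O> (\<lambda>y. X \<omega> y - s n \<omega> y)) \<partial>M)) \<longlonglongrightarrow> 0"
      using ennreal_tendsto_cmult[OF _ s(3), of "ennreal (h1_norm \<O> \<phi>)"] by simp
  qed (use le in \<open>auto intro!: always_eventually\<close>)
  have int_X: "integrable M (\<lambda>\<omega>. X \<omega> \<phi>)"
  proof -
    have "\<forall>\<^sub>F n in sequentially. (\<integral>\<^sup>+\<omega>. norm (s n \<omega> \<phi> - X \<omega> \<phi>) \<partial>M) < \<infinity>"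
      using L1 by (rule order_tendstoD(2)) simp
    then obtain n where "(\<integral>\<^sup>+\<omega>. norm (s n \<omega> \<phi> - X \<omega> \<phi>) \<partial>M) < \<infinity>"
      by (auto simp: eventually_sequentially)
    then have "integrable M (\<lambda>\<omega>. s n \<omega> \<phi> - X \<omega> \<phi>)"
      using borel_measurable_integrable[OF int_s] by (intro integrableI_bounded) auto
    from Bochner_Integration.integrable_diff[OF int_s[of n] this] show ?thesis by simp
  qed
  have "(\<lambda>n. \<integral>\<omega>. s n \<omega> \<phi> \<partial>M) \<longlonglongrightarrow> (\<integral>\<omega>. X \<omega> \<phi> \<partial>M)"
    by (rule tendsto_L1_int[OF int_s int_X L1])
  moreover have "(\<lambda>n. \<integral>\<omega>. s n \<omega> \<phi> \<partial>M) \<longlonglongrightarrow> m \<phi>"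
  proof -
    have "simple_expectation M (s n) \<in> Hm1 \<O>" for n
      by (rule Hm1.simple_expectation_mem[OF s(2)])
    note le = Hm1_apply_le[OF Hm1.diff_mem[OF this m] \<phi>]
    have "(\<lambda>n. Hm1_norm \<O> (\<lambda>y. simple_expectation M (s n) y - m y) * h1_norm \<O> \<phi>) \<longlonglongrightarrow> 0"
      using s(4) by (rule tendsto_mult_left_zero)
    then have "(\<lambda>n. simple_expectation M (s n) \<phi> - m \<phi>) \<longlonglongrightarrow> 0"
      using le by (elim Lim_null_comparison[rotated]) simp
    then show ?thesis
      using simple_expectation_apply(2)[OF M s(1)] by (simp add: LIM_zero_iff)
  qed
  ultimately show ?thesis by (rule LIMSEQ_unique[symmetric])
qed

text \<open>Since \<open>H\<^sup>-\<^sup>1\<close> is a dual space, a candidate for the expectation can be written down pointwise. The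
  means of simple functions that approximate \<open>X\<close> in mean converge to it, because the error at \<open>\<phi>\<close> is
  at most \<open>\<integral> \<parallel>X - s\<^sub>n\<parallel>\<close> times the \<open>H\<^sup>1\<close> norm of \<open>\<phi>\<close>.\<close>

lemma Hm1_has_expectation:
  assumes M: "finite_measure M" and X: "random_elt M (Hm1 \<O>) (Hm1_norm \<O>) X"
    and int: "integrable M (\<lambda>\<omega>. Hm1_norm \<O> (X \<omega>))"
  shows "has_expectation M (Hm1 \<O>) (Hm1_norm \<O>) X (\<lambda>\<phi>. \<integral>\<omega>. X \<omega> \<phi> \<partial>M)"
proof -
  define m where "m \<phi> = (\<integral>\<omega>. X \<omega> \<phi> \<partial>M)" for \<phi>
  have apply_le: "\<bar>X \<omega> \<phi>\<bar> \<le> Hm1_norm \<O> (X \<omega>) * h1_norm \<O> \<phi>"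
    if "\<omega> \<in> space M" "\<phi> \<in> test_fun \<O>" for \<omega> \<phi>
    by (rule Hm1_apply_le[OF random_elt_mem[OF X that(1)] that(2)])
  have int_X: "integrable M (\<lambda>\<omega>. X \<omega> \<phi>)" if \<phi>: "\<phi> \<in> test_fun \<O>" for \<phi>
  proof (rule Bochner_Integration.integrable_bound)
    show "integrable M (\<lambda>\<omega>. Hm1_norm \<O> (X \<omega>) * h1_norm \<O> \<phi>)" using int by simp
    show "AE \<omega> in M. norm (X \<omega> \<phi>) \<le> norm (Hm1_norm \<O> (X \<omega>) * h1_norm \<O> \<phi>)"
      using apply_le[OF _ \<phi>] by (intro AE_I2) (simp add: order_trans[OF _ abs_ge_self])
  qed (rule Hm1_eval_measurable[OF X \<phi>])
  have m: "m \<in> Hm1 \<O>"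
  proof (rule Hm1I)
    show "m \<phi> = 0" if "\<phi> \<notin> test_fun \<O>" for \<phi>
      unfolding m_def using Hm1_zero_outside[OF random_elt_mem[OF X] that]
      by (subst Bochner_Integration.integral_cong[where g="\<lambda>_. 0"]) auto
    show "m (\<lambda>x. a * \<phi> x + b * \<psi> x) = a * m \<phi> + b * m \<psi>"
      if "\<phi> \<in> test_fun \<O>" "\<psi> \<in> test_fun \<O>" for \<phi> \<psi> a b
    proof -
      have "m (\<lambda>x. a * \<phi> x + b * \<psi> x) = (\<integral>\<omega>. a * X \<omega> \<phi> + b * X \<omega> \<psi> \<partial>M)"
        unfolding m_def
        by (intro Bochner_Integration.integral_cong refl Hm1_linear[OF random_elt_mem[OF X] that])
      then show ?thesis using int_X that by (simp add: m_def)
    qed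
    show "\<bar>m \<phi>\<bar> \<le> (\<integral>\<omega>. Hm1_norm \<O> (X \<omega>) \<partial>M) * h1_norm \<O> \<phi>" if \<phi>: "\<phi> \<in> test_fun \<O>" for \<phi>
    proof -
      have "\<bar>m \<phi>\<bar> \<le> (\<integral>\<omega>. \<bar>X \<omega> \<phi>\<bar> \<partial>M)" unfolding m_def by (rule integral_abs_bound)
      also have "\<dots> \<le> (\<integral>\<omega>. Hm1_norm \<O> (X \<omega>) * h1_norm \<O> \<phi> \<partial>M)"
        using int_X[OF \<phi>] int apply_le[OF _ \<phi>] by (intro integral_mono) auto
      finally show ?thesis by simp
    qed
  qed
  obtain s where s: "\<And>n. simple_function M (s n)" "\<And>n \<omega>. \<omega> \<in> space M \<Longrightarrow> s n \<omega> \<in> Hm1 \<O>"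
    and ints: "\<And>n. integrable M (\<lambda>\<omega>. Hm1_norm \<O> (\<lambda>y. X \<omega> y - s n \<omega> y))"
    and lim: "(\<lambda>n. \<integral>\<omega>. Hm1_norm \<O> (\<lambda>y. X \<omega> y - s n \<omega> y) \<partial>M) \<longlonglongrightarrow> 0"
    using Hm1.random_elt_L1_approximation[OF X int] by blast
  have nonneg: "0 \<le> Hm1_norm \<O> (\<lambda>y. X \<omega> y - s n \<omega> y)" if "\<omega> \<in> space M" for \<omega> n
    using that by (intro Hm1.norm_nonneg Hm1.diff_mem s(2) random_elt_mem[OF X])
  have "(\<integral>\<^sup>+\<omega>. ennreal (Hm1_norm \<O> (\<lambda>y. X \<omega> y - s n \<omega> y)) \<partial>M)
      = ennreal (\<integral>\<omega>. Hm1_norm \<O> (\<lambda>y. X \<omega> y - s n \<omega> y) \<partial>M)" for n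
    using nonneg by (intro nn_integral_eq_integral ints AE_I2)
  then have "(\<lambda>n. \<integral>\<^sup>+\<omega>. ennreal (Hm1_norm \<O> (\<lambda>y. X \<omega> y - s n \<omega> y)) \<partial>M) \<longlonglongrightarrow> 0"
    using tendsto_ennrealI[OF lim] by simp
  moreover have "(\<lambda>n. Hm1_norm \<O> (\<lambda>y. simple_expectation M (s n) y - m y)) \<longlonglongrightarrow> 0"
  proof (rule tendsto_sandwich[OF _ _ tendsto_const lim])
    have sC: "simple_expectation M (s n) \<in> Hm1 \<O>" for n
      by (rule Hm1.simple_expectation_mem[OF s(2)])
    show "\<forall>\<^sub>F n in sequentially. 0 \<le> Hm1_norm \<O> (\<lambda>y. simple_expectation M (s n) y - m y)"
      by (intro always_eventually allI Hm1.norm_nonneg Hm1.diff_mem sC m)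
    show "\<forall>\<^sub>F n in sequentially. Hm1_norm \<O> (\<lambda>y. simple_expectation M (s n) y - m y)
        \<le> (\<integral>\<omega>. Hm1_norm \<O> (\<lambda>y. X \<omega> y - s n \<omega> y) \<partial>M)"
    proof (intro always_eventually allI Hm1_norm_le)
      fix n and \<phi> :: "pt \<Rightarrow> real" assume \<phi>: "\<phi> \<in> test_fun \<O>"
      note int_s = simple_expectation_apply(1)[OF M s(1)[of n], of \<phi>]
      have "simple_expectation M (s n) \<phi> - m \<phi> = (\<integral>\<omega>. s n \<omega> \<phi> - X \<omega> \<phi> \<partial>M)"
        using simple_expectation_apply(2)[OF M s(1)[of n], of \<phi>] int_s int_X[OF \<phi>] by (simp add: m_def)
      also have "\<bar>\<dots>\<bar> \<le> (\<integral>\<omega>. \<bar>s n \<omega> \<phi> - X \<omega> \<phi>\<bar> \<partial>M)" by (rule integral_abs_bound)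
      also have "\<dots> \<le> (\<integral>\<omega>. Hm1_norm \<O> (\<lambda>y. X \<omega> y - s n \<omega> y) * h1_norm \<O> \<phi> \<partial>M)"
      proof (rule integral_mono)
        fix \<omega> assume \<omega>: "\<omega> \<in> space M"
        show "\<bar>s n \<omega> \<phi> - X \<omega> \<phi>\<bar> \<le> Hm1_norm \<O> (\<lambda>y. X \<omega> y - s n \<omega> y) * h1_norm \<O> \<phi>"
          using Hm1_apply_le[OF Hm1.diff_mem[OF random_elt_mem[OF X \<omega>] s(2)[OF \<omega>]] \<phi>, of n]
          by (simp add: abs_minus_commute)
      qed (use int_s int_X[OF \<phi>] ints in auto)
      finally show "\<bar>simple_expectation M (s n) \<phi> - m \<phi>\<bar>
          \<le> (\<integral>\<omega>. Hm1_norm \<O> (\<lambda>y. X \<omega> y - s n \<omega> y) \<partial>M) * h1_norm \<O> \<phi>" by simp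
    qed (intro integral_nonneg_AE AE_I2 nonneg)
  qed
  ultimately have "has_expectation M (Hm1 \<O>) (Hm1_norm \<O>) X m"
    unfolding has_expectation_def using X m s(1,2) by (intro conjI exI[of _ s]) auto
  then show ?thesis by (simp add: m_def[abs_def])
qed

lemma Hm1_expectation_eq:
  assumes M: "finite_measure M" and X: "random_elt M (Hm1 \<O>) (Hm1_norm \<O>) X"
    and int: "integrable M (\<lambda>\<omega>. Hm1_norm \<O> (X \<omega>))"
  shows "Hm1_integrable M \<O> X" "Hm1_expectation M \<O> X = (\<lambda>\<phi>. \<integral>\<omega>. X \<omega> \<phi> \<partial>M)"
proof -
  note E = Hm1_has_expectation[OF assms]
  show "Hm1_integrable M \<O> X" using E by (auto simp: Hm1_integrable_def)
  show "Hm1_expectation M \<O> X = (\<lambda>\<phi>. \<integral>\<omega>. X \<omega> \<phi> \<partial>M)"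
    unfolding Hm1_expectation_def
  proof (rule the_equality, rule E)
    fix m assume m: "has_expectation M (Hm1 \<O>) (Hm1_norm \<O>) X m"
    show "m = (\<lambda>\<phi>. \<integral>\<omega>. X \<omega> \<phi> \<partial>M)"
    proof
      fix \<phi>
      have "m \<in> Hm1 \<O>" "(\<lambda>\<phi>. \<integral>\<omega>. X \<omega> \<phi> \<partial>M) \<in> Hm1 \<O>"
        using m E by (simp_all add: has_expectation_def)
      from this[THEN Hm1_zero_outside, of \<phi>] show "m \<phi> = (\<integral>\<omega>. X \<omega> \<phi> \<partial>M)"
        using has_expectation_Hm1_apply[OF M m, of \<phi>] by (cases "\<phi> \<in> test_fun \<O>") simp_all
    qed
  qed
qed

section \<open>The increments of the Wiener process have mean zero\<close>

lemma l2_inner_sum: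
  assumes "\<And>i. i \<in> I \<Longrightarrow> f i \<in> L2 \<O>" "g \<in> L2 \<O>"
  shows "l2_inner \<O> (\<lambda>x. \<Sum>i\<in>I. a i *\<^sub>R f i x) g = (\<Sum>i\<in>I. a i * l2_inner \<O> (f i) g)"
proof -
  have "l2_inner \<O> (\<lambda>x. \<Sum>i\<in>I. a i *\<^sub>R f i x) g
      = (\<integral>x. (\<Sum>i\<in>I. a i * (f i x \<bullet> g x)) \<partial>lebesgue_on \<O>)"
    by (simp add: l2_inner_def inner_sum_left)
  also have "\<dots> = (\<Sum>i\<in>I. \<integral>x. a i * (f i x \<bullet> g x) \<partial>lebesgue_on \<O>)"
    using assms by (intro Bochner_Integration.integral_sum integrable_mult_right L2_integrable_inner) auto
  finally show ?thesis by (simp add: l2_inner_def)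
qed

lemma l2_inner_random_integrable:
  fixes X :: "'a \<Rightarrow> pt \<Rightarrow> 'b::euclidean_space"
  assumes X: "random_elt M (L2 \<O>) (l2_norm \<O>) X" and int: "integrable M (\<lambda>\<omega>. l2_norm \<O> (X \<omega>))"
    and g: "g \<in> L2 \<O>"
  shows "integrable M (\<lambda>\<omega>. l2_inner \<O> (X \<omega>) g)"
proof (rule Bochner_Integration.integrable_bound)
  show "integrable M (\<lambda>\<omega>. l2_norm \<O> (X \<omega>) * l2_norm \<O> g)" using int by simp
  show "(\<lambda>\<omega>. l2_inner \<O> (X \<omega>) g) \<in> borel_measurable M"
    using X
  proof (rule L2.random_elt_functional_measurable)
    fix u v :: "pt \<Rightarrow> 'b" assume "u \<in> L2 \<O>" "v \<in> L2 \<O>"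
    then show "\<bar>l2_inner \<O> u g - l2_inner \<O> v g\<bar> \<le> l2_norm \<O> g * l2_norm \<O> (\<lambda>y. u y - v y)"
      using l2_Cauchy_Schwarz[OF L2.diff_mem g] g by (simp add: l2_inner_diff mult.commute)
  qed
  show "AE \<omega> in M. norm (l2_inner \<O> (X \<omega>) g) \<le> norm (l2_norm \<O> (X \<omega>) * l2_norm \<O> g)"
    using l2_Cauchy_Schwarz[OF random_elt_mem[OF X] g]
    by (intro AE_I2) (simp add: order_trans[OF _ abs_ge_self])
qed

lemma brownian_motion_mean_zero:
  assumes basis: "stochastic_basis M \<F>" and b: "std_brownian_motion M \<F> b" and t: "t \<ge> 0"
  shows "integrable M (b t)" "(\<integral>\<omega>. b t \<omega> \<partial>M) = 0"
proof -
  interpret prob_space M using basis by (simp add: stochastic_basis_def)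
  have bm [measurable]: "b r \<in> borel_measurable M" if "r \<ge> 0" for r
    using basis b that measurable_from_subalg[of M "\<F> r" "b r"]
    by (simp add: stochastic_basis_def std_brownian_motion_def)
  have b0: "AE \<omega> in M. b 0 \<omega> = 0" using b by (simp add: std_brownian_motion_def)
  have "integrable M (b t) \<and> (\<integral>\<omega>. b t \<omega> \<partial>M) = 0"
  proof (cases "t = 0")
    case True
    have "integrable M (b 0) \<longleftrightarrow> integrable M (\<lambda>\<omega>. 0 :: real)"
      using b0 by (intro integrable_cong_AE bm) auto
    with True integral_eq_zero_AE[OF b0] show ?thesis by simp
  next
    case False
    with t have t: "t > 0" by simp
    define d where "d \<omega> = b t \<omega> - b 0 \<omega>" for \<omega>
    have D: "distributed M lborel d (normal_density 0 (sqrt t))"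
    proof -
      have "\<forall>s t. 0 \<le> s \<longrightarrow> s < t \<longrightarrow>
          distributed M lborel (\<lambda>\<omega>. b t \<omega> - b s \<omega>) (normal_density 0 (sqrt (t - s)))"
        using b unfolding std_brownian_motion_def by (elim conjE)
      then have "distributed M lborel (\<lambda>\<omega>. b t \<omega> - b 0 \<omega>) (normal_density 0 (sqrt (t - 0)))"
        using t by (elim allE impE) (rule order_refl)
      moreover have "d = (\<lambda>\<omega>. b t \<omega> - b 0 \<omega>)" by (rule ext) (rule d_def)
      ultimately show ?thesis by simp
    qed
    have int_d: "integrable M d"
      using t by (intro distributed_integrable_var[OF D] integrable_normal_moment_nz_1) auto
    have "expectation d = 0"
      using t by (intro normal_distributed_expectation[OF _ D]) simp
    moreover have eq: "AE \<omega> in M. b t \<omega> = d \<omega>"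
      using b0 by eventually_elim (simp add: d_def)
    moreover have "integrable M (b t) \<longleftrightarrow> integrable M d"
      using eq t borel_measurable_integrable[OF int_d] by (intro integrable_cong_AE bm) auto
    moreover have "(\<integral>\<omega>. b t \<omega> \<partial>M) = (\<integral>\<omega>. d \<omega> \<partial>M)"
      using eq t borel_measurable_integrable[OF int_d] by (intro integral_cong_AE bm) auto
    ultimately show ?thesis using int_d by simp
  qed
  then show "integrable M (b t)" "(\<integral>\<omega>. b t \<omega> \<partial>M) = 0" by blast+
qed

text \<open>The partial sums of the series have mean zero when paired with \<open>u\<close>, and they approximate \<open>W t\<close> in
  mean square, hence in mean. Of the remainder \<open>D n\<close> only the integral of its squared norm is
  controlled, and measurability of that norm is not at hand; the estimates are therefore made for the scalar functions \<open>d\<close> and \<open>Y n\<close>,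
  which are measurable and bounded by that norm.\<close>

lemma wiener_integrable_mean_zero:
  fixes \<O> :: "pt set"
  assumes basis: "stochastic_basis M \<F>" and bm: "\<And>k. std_brownian_motion M \<F> (\<beta> k)"
    and R: "\<And>k. R (e k) \<in> L2 \<O>" and W: "wiener_series \<O> M \<F> R e \<beta> W" and t: "t \<ge> 0"
  shows "random_elt M (L2 \<O>) (l2_norm \<O>) (W t)" "integrable M (\<lambda>\<omega>. l2_norm \<O> (W t \<omega>))"
    and "u \<in> L2 \<O> \<Longrightarrow> (\<integral>\<omega>. l2_inner \<O> (W t \<omega>) u \<partial>M) = 0"
proof -
  interpret prob_space M using basis by (simp add: stochastic_basis_def)
  show X: "random_elt M (L2 \<O>) (l2_norm \<O>) (W t)"
  proof (rule random_elt_subalgebra)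
    show "random_elt (\<F> t) (L2 \<O>) (l2_norm \<O>) (W t)" using W t by (simp add: wiener_series_def)
    show "subalgebra M (\<F> t)" using basis t by (simp add: stochastic_basis_def)
  qed
  have norm_meas: "(\<lambda>\<omega>. l2_norm \<O> (W t \<omega>)) \<in> borel_measurable M"
    by (rule L2.random_elt_norm_measurable[OF X])
  have int_b: "integrable M (\<beta> k t)" and mean_b: "(\<integral>\<omega>. \<beta> k t \<omega> \<partial>M) = 0" for k
    by (rule brownian_motion_mean_zero[OF basis bm t])+
  define P where "P n \<omega> = (\<lambda>x. \<Sum>k<n. \<beta> k t \<omega> *\<^sub>R R (e k) x)" for n \<omega>
  define D where "D n \<omega> = (\<lambda>x. W t \<omega> x - P n \<omega> x)" for n \<omega>
  have P: "P n \<omega> \<in> L2 \<O>" for n \<omega>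
    unfolding P_def by (intro L2.sum_mem R)
  have lim: "(\<lambda>n. \<integral>\<^sup>+\<omega>. ennreal ((l2_norm \<O> (D n \<omega>))\<^sup>2) \<partial>M) \<longlonglongrightarrow> 0"
    using W t by (simp add: wiener_series_def D_def P_def mult.commute)
  show int: "integrable M (\<lambda>\<omega>. l2_norm \<O> (W t \<omega>))"
  proof -
    have "\<forall>\<^sub>F n in sequentially. (\<integral>\<^sup>+\<omega>. ennreal ((l2_norm \<O> (D n \<omega>))\<^sup>2) \<partial>M) < \<infinity>"
      using lim by (rule order_tendstoD(2)) simp
    then obtain n where n: "(\<integral>\<^sup>+\<omega>. ennreal ((l2_norm \<O> (D n \<omega>))\<^sup>2) \<partial>M) < \<infinity>"
      by (auto simp: eventually_sequentially)
    define h where "h \<omega> = (\<Sum>k<n. \<bar>\<beta> k t \<omega>\<bar> * l2_norm \<O> (R (e k)))" for \<omega>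
    have int_h: "integrable M h"
      unfolding h_def by (intro Bochner_Integration.integrable_sum integrable_mult_left integrable_abs int_b)
    define d where "d \<omega> = max 0 (l2_norm \<O> (W t \<omega>) - h \<omega>)" for \<omega>
    have d_meas: "d \<in> borel_measurable M"
      unfolding d_def
      by (intro borel_measurable_max borel_measurable_diff borel_measurable_const norm_meas
          borel_measurable_integrable[OF int_h])
    have dD: "d \<omega> \<le> l2_norm \<O> (D n \<omega>)" if \<omega>: "\<omega> \<in> space M" for \<omega>
    proof -
      have "l2_norm \<O> (P n \<omega>) \<le> h \<omega>"
        unfolding P_def h_def by (intro L2.norm_sum_le R)
      with L2.norm_le_add_diff[OF random_elt_mem[OF X \<omega>] P, of n \<omega>] show ?thesis
        by (simp add: d_def D_def l2_norm_nonneg)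
    qed
    have "(\<integral>\<^sup>+\<omega>. ennreal (norm ((d \<omega>)\<^sup>2)) \<partial>M) \<le> (\<integral>\<^sup>+\<omega>. ennreal ((l2_norm \<O> (D n \<omega>))\<^sup>2) \<partial>M)"
    proof (intro nn_integral_mono ennreal_leI)
      fix \<omega> assume "\<omega> \<in> space M"
      from power_mono[OF dD[OF this], of 2] show "norm ((d \<omega>)\<^sup>2) \<le> (l2_norm \<O> (D n \<omega>))\<^sup>2"
        by (simp add: d_def)
    qed
    then have "(\<integral>\<^sup>+\<omega>. ennreal (norm ((d \<omega>)\<^sup>2)) \<partial>M) < \<infinity>"
      using n by (rule le_less_trans)
    then have "integrable M (\<lambda>\<omega>. (d \<omega>)\<^sup>2)" by (intro integrableI_bounded borel_measurable_power d_meas)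
    then have "integrable M d" by (rule square_integrable_imp_integrable[OF d_meas])
    then have "integrable M (\<lambda>\<omega>. d \<omega> + h \<omega>)" by (intro Bochner_Integration.integrable_add int_h)
    then show ?thesis
    proof (rule Bochner_Integration.integrable_bound)
      show "AE \<omega> in M. norm (l2_norm \<O> (W t \<omega>)) \<le> norm (d \<omega> + h \<omega>)"
      proof (rule AE_I2)
        fix \<omega>
        have "l2_norm \<O> (W t \<omega>) \<le> d \<omega> + h \<omega>" by (simp add: d_def)
        then show "norm (l2_norm \<O> (W t \<omega>)) \<le> norm (d \<omega> + h \<omega>)"
          using l2_norm_nonneg[of \<O> "W t \<omega>"] by simp
      qed
    qed (rule norm_meas)
  qed
  assume u: "u \<in> L2 \<O>"
  define m where "m = (\<integral>\<omega>. l2_inner \<O> (W t \<omega>) u \<partial>M)"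
  have int_u: "integrable M (\<lambda>\<omega>. l2_inner \<O> (W t \<omega>) u)"
    by (rule l2_inner_random_integrable[OF X int u])
  \<comment> \<open>The summand \<open>1\<close> keeps \<open>c\<close> positive when \<open>u\<close> vanishes almost everywhere.\<close>
  define c where "c = l2_norm \<O> u + 1"
  have c: "c > 0" "l2_norm \<O> u \<le> c" using l2_norm_nonneg[of \<O> u] by (simp_all add: c_def)
  define Y where "Y n \<omega> = (l2_inner \<O> (W t \<omega>) u - (\<Sum>k<n. \<beta> k t \<omega> * l2_inner \<O> (R (e k)) u)) / c" for n \<omega>
  have int_Y: "integrable M (Y n)" for n
    unfolding Y_def using int_u int_b
    by (intro integrable_divide Bochner_Integration.integrable_diff Bochner_Integration.integrable_sum
        integrable_mult_left) auto
  have mean_Y: "(\<integral>\<omega>. Y n \<omega> \<partial>M) = m / c" for n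
    unfolding Y_def m_def using int_u int_b mean_b by (simp add: Bochner_Integration.integral_sum)
  have YD: "\<bar>Y n \<omega>\<bar> \<le> l2_norm \<O> (D n \<omega>)" if \<omega>: "\<omega> \<in> space M" for n \<omega>
  proof -
    have "l2_inner \<O> (P n \<omega>) u = (\<Sum>k<n. \<beta> k t \<omega> * l2_inner \<O> (R (e k)) u)"
      unfolding P_def by (intro l2_inner_sum R u)
    then have "Y n \<omega> = l2_inner \<O> (D n \<omega>) u / c"
      using l2_inner_diff[OF random_elt_mem[OF X \<omega>] P u, of n \<omega>] by (simp add: Y_def D_def)
    moreover have "\<bar>l2_inner \<O> (D n \<omega>) u\<bar> \<le> l2_norm \<O> (D n \<omega>) * l2_norm \<O> u"
      unfolding D_def using random_elt_mem[OF X \<omega>] P u by (intro l2_Cauchy_Schwarz L2.diff_mem)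
    moreover have "l2_norm \<O> (D n \<omega>) * l2_norm \<O> u \<le> l2_norm \<O> (D n \<omega>) * c"
      using c by (intro mult_left_mono l2_norm_nonneg)
    ultimately have "\<bar>Y n \<omega>\<bar> = \<bar>l2_inner \<O> (D n \<omega>) u\<bar> / c"
        and "\<bar>l2_inner \<O> (D n \<omega>) u\<bar> \<le> l2_norm \<O> (D n \<omega>) * c"
      using c by auto
    then show ?thesis using c by (simp add: pos_divide_le_eq)
  qed
  \<comment> \<open>Jensen's inequality: the square of the mean is at most the second moment.\<close>
  have "ennreal ((m / c)\<^sup>2) \<le> (\<integral>\<^sup>+\<omega>. ennreal ((l2_norm \<O> (D n \<omega>))\<^sup>2) \<partial>M)" for n
  proof -
    have le: "(\<integral>\<^sup>+\<omega>. ennreal ((Y n \<omega>)\<^sup>2) \<partial>M) \<le> (\<integral>\<^sup>+\<omega>. ennreal ((l2_norm \<O> (D n \<omega>))\<^sup>2) \<partial>M)"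
    proof (intro nn_integral_mono ennreal_leI)
      fix \<omega> assume "\<omega> \<in> space M"
      from power_mono[OF YD[OF this] abs_ge_zero, of n 2] show "(Y n \<omega>)\<^sup>2 \<le> (l2_norm \<O> (D n \<omega>))\<^sup>2"
        by simp
    qed
    show ?thesis
    proof (cases "(\<integral>\<^sup>+\<omega>. ennreal ((Y n \<omega>)\<^sup>2) \<partial>M) < \<infinity>")
      case True
      then have int2: "integrable M (\<lambda>\<omega>. (Y n \<omega>)\<^sup>2)"
        using borel_measurable_integrable[OF int_Y[of n]] by (intro integrableI_bounded) auto
      have "(m / c)\<^sup>2 \<le> (\<integral>\<omega>. (Y n \<omega>)\<^sup>2 \<partial>M)"
        using variance_eq[OF int_Y int2] variance_positive[of "Y n"] by (simp add: mean_Y)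
      then have "ennreal ((m / c)\<^sup>2) \<le> (\<integral>\<^sup>+\<omega>. ennreal ((Y n \<omega>)\<^sup>2) \<partial>M)"
        using nn_integral_eq_integral[OF int2] by (simp add: ennreal_leI)
      with le show ?thesis by (rule order_trans[rotated])
    next
      case False
      with le have "(\<integral>\<^sup>+\<omega>. ennreal ((l2_norm \<O> (D n \<omega>))\<^sup>2) \<partial>M) = top"
        by (simp add: not_less top_unique)
      then show ?thesis by simp
    qed
  qed
  then have "ennreal ((m / c)\<^sup>2) \<le> 0"
    by (intro LIMSEQ_le_const[OF lim]) auto
  then have "(m / c)\<^sup>2 \<le> 0" by (simp add: ennreal_eq_0_iff)
  with c show "(\<integral>\<omega>. l2_inner \<O> (W t \<omega>) u \<partial>M) = 0" by (simp add: m_def)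
qed

section \<open>The averaged divergence of the exponential integrator\<close>

text \<open>The vector \<open>(\<lambda>\<^sub>1, \<lambda>\<^sub>1, \<lambda>\<^sub>1, \<lambda>\<^sub>2, \<lambda>\<^sub>2, \<lambda>\<^sub>2)\<close>: the noise is a scalar field times this constant.\<close>

definition noise_direction :: "real \<Rightarrow> real \<Rightarrow> em" where
  "noise_direction a b = (\<chi> i. a, \<chi> i. b)"

lemma noise_coeff_eq: "noise_coeff a b u = (\<lambda>x. u x *\<^sub>R noise_direction a b)"
  by (simp add: noise_coeff_def noise_direction_def fun_eq_iff vec_eq_iff mult.commute)

lemma noise_coeff_in_L2:
  assumes "u \<in> L2 \<O>"
  shows "noise_coeff a b u \<in> L2 \<O>"
proof (rule L2_dominated[OF assms])
  show "noise_coeff a b u \<in> borel_measurable (lebesgue_on \<O>)"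
    unfolding noise_coeff_eq using L2_measurable[OF assms]
    by (intro borel_measurable_scaleR borel_measurable_const)
  show "norm (noise_coeff a b u x) \<le> norm (noise_direction a b) * norm (u x)" for x
    by (simp add: noise_coeff_eq mult.commute)
qed

lemma l2_norm_noise_coeff:
  "l2_norm \<O> (noise_coeff a b u) = norm (noise_direction a b) * l2_norm \<O> u"
proof -
  have "l2_inner \<O> (noise_coeff a b u) (noise_coeff a b u)
      = (\<integral>x. (u x * u x) * (norm (noise_direction a b))\<^sup>2 \<partial>lebesgue_on \<O>)"
    by (simp add: noise_coeff_eq l2_inner_def power2_norm_eq_inner mult.assoc)
  also have "\<dots> = l2_inner \<O> u u * (norm (noise_direction a b))\<^sup>2"
    by (simp add: l2_inner_def)
  finally show ?thesis by (simp add: l2_norm_def real_sqrt_mult)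
qed

lemma noise_coeff_diff:
  "noise_coeff a b u x - noise_coeff a b v x = noise_coeff a b (\<lambda>x. u x - v x) x"
  by (simp add: noise_coeff_eq scaleR_diff_left)

lemma l2_inner_noise_coeff:
  "l2_inner \<O> (noise_coeff a b u) v = l2_inner \<O> u (\<lambda>x. noise_direction a b \<bullet> v x)"
  by (simp add: noise_coeff_eq l2_inner_def)

lemma inner_const_in_L2:
  fixes v :: "pt \<Rightarrow> 'b::euclidean_space"
  assumes v: "v \<in> L2 \<O>"
  shows "(\<lambda>x. c \<bullet> v x) \<in> L2 \<O>"
proof (rule L2_dominated[OF v])
  show "(\<lambda>x. c \<bullet> v x) \<in> borel_measurable (lebesgue_on \<O>)"
    using v by measurable
  show "norm (c \<bullet> v x) \<le> norm c * norm (v x)" for x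
    by (simp add: Cauchy_Schwarz_ineq2)
qed

lemma maxwell_dom_random_elt:
  assumes "random_elt M (maxwell_dom \<O>) (graph_norm \<O>) X"
  shows "random_elt M (L2 \<O>) (l2_norm \<O>) X"
proof (rule random_elt_Lipschitz_image[OF assms, where T="\<lambda>u. u" and K=1])
  show "l2_norm \<O> (\<lambda>y. u y - v y) \<le> 1 * graph_norm \<O> (\<lambda>y. u y - v y)" for u v
    unfolding graph_norm_def by (simp add: real_le_rsqrt)
qed (simp_all add: maxwell_dom_subset_L2 l2_norm_nonneg)

context
  fixes \<O> :: "pt set" and M :: "'a measure" and \<F> :: "real \<Rightarrow> 'a measure"
    and S :: "real \<Rightarrow> (pt \<Rightarrow> em) \<Rightarrow> (pt \<Rightarrow> em)" and R :: "(pt \<Rightarrow> real) \<Rightarrow> (pt \<Rightarrow> real)"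
    and e :: "nat \<Rightarrow> pt \<Rightarrow> real" and \<beta> :: "nat \<Rightarrow> real \<Rightarrow> 'a \<Rightarrow> real"
    and W :: "real \<Rightarrow> 'a \<Rightarrow> pt \<Rightarrow> real" and U0 :: "'a \<Rightarrow> pt \<Rightarrow> em" and a b dt :: real
  assumes S: "unitary_C0_group \<O> S"
    and basis: "stochastic_basis M \<F>"
    and bm: "\<And>k. std_brownian_motion M \<F> (\<beta> k)"
    and R: "\<And>k. R (e k) \<in> L2 \<O>"
    and W: "wiener_series \<O> M \<F> R e \<beta> W"
    and dt: "dt > 0"
    and U0: "random_elt M (L2 \<O>) (l2_norm \<O>) U0"
    and U0_int: "integrable M (\<lambda>\<omega>. l2_norm \<O> (U0 \<omega>))"
begin

text \<open>Pairing the noise with \<open>g\<close> amounts to pairing the scalar increment with the inner product of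
  \<open>g\<close> and the noise direction.\<close>

lemma noise_increment_mean_zero:
  assumes "0 \<le> s" "0 \<le> t" and Y_def: "Y = (\<lambda>\<omega>. noise_coeff a b (\<lambda>x. W t \<omega> x - W s \<omega> x))"
  shows "random_elt M (L2 \<O>) (l2_norm \<O>) Y" "integrable M (\<lambda>\<omega>. l2_norm \<O> (Y \<omega>))"
    and "g \<in> L2 \<O> \<Longrightarrow> (\<integral>\<omega>. l2_inner \<O> (Y \<omega>) g \<partial>M) = 0"
proof -
  note Wt = wiener_integrable_mean_zero[OF basis bm R W \<open>0 \<le> t\<close>]
  note Ws = wiener_integrable_mean_zero[OF basis bm R W \<open>0 \<le> s\<close>]
  define d where "d \<omega> = (\<lambda>x. W t \<omega> x - W s \<omega> x)" for \<omega>
  have Y: "Y \<omega> = noise_coeff a b (d \<omega>)" for \<omega> by (simp add: Y_def d_def)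
  have d: "random_elt M (L2 \<O>) (l2_norm \<O>) d"
    using L2.random_elt_add[OF Wt(1) L2.random_elt_scale[OF Ws(1), of "-1"]]
    by (simp add: d_def[abs_def])
  have int_d: "integrable M (\<lambda>\<omega>. l2_norm \<O> (d \<omega>))"
  proof (rule Bochner_Integration.integrable_bound)
    show "integrable M (\<lambda>\<omega>. l2_norm \<O> (W t \<omega>) + l2_norm \<O> (W s \<omega>))" using Wt(2) Ws(2) by simp
    show "AE \<omega> in M. norm (l2_norm \<O> (d \<omega>)) \<le> norm (l2_norm \<O> (W t \<omega>) + l2_norm \<O> (W s \<omega>))"
    proof (rule AE_I2)
      fix \<omega> assume \<omega>: "\<omega> \<in> space M"
      show "norm (l2_norm \<O> (d \<omega>)) \<le> norm (l2_norm \<O> (W t \<omega>) + l2_norm \<O> (W s \<omega>))"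
        using L2.norm_triangle[OF random_elt_mem[OF Wt(1) \<omega>]
            L2.scale_mem[OF random_elt_mem[OF Ws(1) \<omega>], of "-1"]]
          L2.norm_scale[OF random_elt_mem[OF Ws(1) \<omega>], of "-1"]
        by (simp add: d_def l2_norm_nonneg)
    qed
  qed (rule L2.random_elt_norm_measurable[OF d])
  show "random_elt M (L2 \<O>) (l2_norm \<O>) Y"
    unfolding Y[abs_def]
    by (rule random_elt_Lipschitz_image[OF d, where K="norm (noise_direction a b)"])
      (simp_all add: noise_coeff_in_L2 noise_coeff_diff l2_norm_noise_coeff l2_norm_nonneg)
  show "integrable M (\<lambda>\<omega>. l2_norm \<O> (Y \<omega>))"
    using int_d by (simp add: Y l2_norm_noise_coeff)
  assume g: "g \<in> L2 \<O>"
  define g' where "g' = (\<lambda>x. noise_direction a b \<bullet> g x)"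
  have g': "g' \<in> L2 \<O>" unfolding g'_def by (rule inner_const_in_L2[OF g])
  have "(\<integral>\<omega>. l2_inner \<O> (Y \<omega>) g \<partial>M) = (\<integral>\<omega>. l2_inner \<O> (W t \<omega>) g' - l2_inner \<O> (W s \<omega>) g' \<partial>M)"
    using random_elt_mem[OF Wt(1)] random_elt_mem[OF Ws(1)] g'
    by (intro Bochner_Integration.integral_cong)
      (simp_all add: Y l2_inner_noise_coeff g'_def[symmetric] d_def l2_inner_diff)
  also have "\<dots> = 0"
    using l2_inner_random_integrable[OF Wt(1,2) g'] l2_inner_random_integrable[OF Ws(1,2) g']
      Wt(3)[OF g'] Ws(3)[OF g'] by simp
  finally show "(\<integral>\<omega>. l2_inner \<O> (Y \<omega>) g \<partial>M) = 0" .
qed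

lemma group_random_elt:
  assumes X: "random_elt M (L2 \<O>) (l2_norm \<O>) X" and int: "integrable M (\<lambda>\<omega>. l2_norm \<O> (X \<omega>))"
  shows "random_elt M (L2 \<O>) (l2_norm \<O>) (\<lambda>\<omega>. S t (X \<omega>))"
    and "integrable M (\<lambda>\<omega>. l2_norm \<O> (S t (X \<omega>)))"
proof -
  show "random_elt M (L2 \<O>) (l2_norm \<O>) (\<lambda>\<omega>. S t (X \<omega>))"
    by (rule random_elt_Lipschitz_image[OF X, where K=1])
      (simp_all add: group_mem[OF S] group_norm_diff[OF S] l2_norm_nonneg)
  have "integrable M (\<lambda>\<omega>. l2_norm \<O> (S t (X \<omega>))) \<longleftrightarrow> integrable M (\<lambda>\<omega>. l2_norm \<O> (X \<omega>))"
    using random_elt_mem[OF X]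
    by (intro Bochner_Integration.integrable_cong) (simp_all add: group_norm[OF S])
  with int show "integrable M (\<lambda>\<omega>. l2_norm \<O> (S t (X \<omega>)))" by simp
qed

text \<open>In the induction step \<open>S dt\<close> is moved to the other side of the pairing. The noise is then paired
  with the fixed field \<open>S (- dt) g\<close> and drops out; the induction hypothesis is used for that same field,
  which is why \<open>g\<close> has to be arbitrary.\<close>

lemma exp_integrator_mean:
  defines "U \<equiv> exp_integrator S (noise_coeff a b) W dt U0"
  shows "random_elt M (L2 \<O>) (l2_norm \<O>) (U k)" "integrable M (\<lambda>\<omega>. l2_norm \<O> (U k \<omega>))"
    and "g \<in> L2 \<O> \<Longrightarrow>
      (\<integral>\<omega>. l2_inner \<O> (U k \<omega>) g \<partial>M) = (\<integral>\<omega>. l2_inner \<O> (S (real k * dt) (U0 \<omega>)) g \<partial>M)"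
proof -
  have "random_elt M (L2 \<O>) (l2_norm \<O>) (U k) \<and> integrable M (\<lambda>\<omega>. l2_norm \<O> (U k \<omega>)) \<and>
    (\<forall>g\<in>L2 \<O>. (\<integral>\<omega>. l2_inner \<O> (U k \<omega>) g \<partial>M) = (\<integral>\<omega>. l2_inner \<O> (S (real k * dt) (U0 \<omega>)) g \<partial>M))"
  proof (induction k)
    case 0
    have "(\<integral>\<omega>. l2_inner \<O> (U0 \<omega>) g \<partial>M) = (\<integral>\<omega>. l2_inner \<O> (S 0 (U0 \<omega>)) g \<partial>M)" if "g \<in> L2 \<O>" for g
      using random_elt_mem[OF U0] that group_zero[OF S] group_mem[OF S]
      by (intro Bochner_Integration.integral_cong refl l2_inner_cong_ae[symmetric]) auto
    then show ?case using U0 U0_int by (simp add: U_def)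
  next
    case (Suc k)
    define Y where
      "Y = (\<lambda>\<omega>. noise_coeff a b (\<lambda>x. W (real (Suc k) * dt) \<omega> x - W (real k * dt) \<omega> x))"
    have Uk: "random_elt M (L2 \<O>) (l2_norm \<O>) (U k)" "integrable M (\<lambda>\<omega>. l2_norm \<O> (U k \<omega>))"
      using Suc by auto
    have times: "0 \<le> real k * dt" "0 \<le> real (Suc k) * dt" using dt by simp_all
    note Y = noise_increment_mean_zero[OF times Y_def]
    note SU = group_random_elt[OF Uk, of dt] and SY = group_random_elt[OF Y(1,2), of dt]
    have rec: "U (Suc k) = (\<lambda>\<omega> x. S dt (U k \<omega>) x + S dt (Y \<omega>) x)"
      by (simp add: U_def Y_def)
    have U: "random_elt M (L2 \<O>) (l2_norm \<O>) (U (Suc k))"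
      unfolding rec by (rule L2.random_elt_add[OF SU(1) SY(1)])
    moreover have "integrable M (\<lambda>\<omega>. l2_norm \<O> (U (Suc k) \<omega>))"
    proof (rule Bochner_Integration.integrable_bound)
      show "integrable M (\<lambda>\<omega>. l2_norm \<O> (S dt (U k \<omega>)) + l2_norm \<O> (S dt (Y \<omega>)))"
        using SU(2) SY(2) by simp
      show "AE \<omega> in M. norm (l2_norm \<O> (U (Suc k) \<omega>))
          \<le> norm (l2_norm \<O> (S dt (U k \<omega>)) + l2_norm \<O> (S dt (Y \<omega>)))"
        using L2.norm_triangle[OF random_elt_mem[OF SU(1)] random_elt_mem[OF SY(1)]]
        by (intro AE_I2) (simp add: rec l2_norm_nonneg)
    qed (rule L2.random_elt_norm_measurable[OF U])
    moreover have "(\<integral>\<omega>. l2_inner \<O> (U (Suc k) \<omega>) g \<partial>M)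
        = (\<integral>\<omega>. l2_inner \<O> (S (real (Suc k) * dt) (U0 \<omega>)) g \<partial>M)" if g: "g \<in> L2 \<O>" for g
    proof -
      define g' where "g' = S (- dt) g"
      have g': "g' \<in> L2 \<O>" unfolding g'_def by (rule group_mem[OF S g])
      have "(\<integral>\<omega>. l2_inner \<O> (U (Suc k) \<omega>) g \<partial>M)
          = (\<integral>\<omega>. l2_inner \<O> (U k \<omega>) g' + l2_inner \<O> (Y \<omega>) g' \<partial>M)"
        using random_elt_mem[OF Uk(1)] random_elt_mem[OF Y(1)] g
        by (intro Bochner_Integration.integral_cong)
          (simp_all add: rec g'_def l2_inner_add group_mem[OF S] group_adjoint[OF S])
      also have "\<dots> = (\<integral>\<omega>. l2_inner \<O> (U k \<omega>) g' \<partial>M)"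
        using l2_inner_random_integrable[OF Uk g'] l2_inner_random_integrable[OF Y(1,2) g'] Y(3)[OF g']
        by simp
      also have "\<dots> = (\<integral>\<omega>. l2_inner \<O> (S (real k * dt) (U0 \<omega>)) g' \<partial>M)"
        using Suc g' by simp
      also have "\<dots> = (\<integral>\<omega>. l2_inner \<O> (S (dt + real k * dt) (U0 \<omega>)) g \<partial>M)"
      proof (intro Bochner_Integration.integral_cong refl)
        fix \<omega> assume "\<omega> \<in> space M"
        then have u: "U0 \<omega> \<in> L2 \<O>" by (rule random_elt_mem[OF U0])
        have "l2_inner \<O> (S (real k * dt) (U0 \<omega>)) g' = l2_inner \<O> (S dt (S (real k * dt) (U0 \<omega>))) g"
          unfolding g'_def by (rule group_adjoint[OF S group_mem[OF S u] g, symmetric])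
        also have "\<dots> = l2_inner \<O> (S (dt + real k * dt) (U0 \<omega>)) g"
          using group_add[OF S u] by (intro l2_inner_cong_ae[symmetric] group_mem[OF S] u g)
        finally show "l2_inner \<O> (S (real k * dt) (U0 \<omega>)) g'
            = l2_inner \<O> (S (dt + real k * dt) (U0 \<omega>)) g" .
      qed
      finally show ?thesis by (simp add: algebra_simps)
    qed
    ultimately show ?case by blast
  qed
  then show "random_elt M (L2 \<O>) (l2_norm \<O>) (U k)" "integrable M (\<lambda>\<omega>. l2_norm \<O> (U k \<omega>))"
    and "g \<in> L2 \<O> \<Longrightarrow>
      (\<integral>\<omega>. l2_inner \<O> (U k \<omega>) g \<partial>M) = (\<integral>\<omega>. l2_inner \<O> (S (real k * dt) (U0 \<omega>)) g \<partial>M)"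
    by auto
qed

text \<open>The conservation law is applied along the orbit of \<open>U0 \<omega>\<close>, which stays in the domain of the
  generator, and not along the iterates, which may leave it.\<close>

lemma exp_integrator_mean_conserved:
  assumes gen: "generated_by_maxwell \<O> S" and U0_dom: "\<And>\<omega>. \<omega> \<in> space M \<Longrightarrow> U0 \<omega> \<in> maxwell_dom \<O>"
    and g: "g \<in> L2 \<O>" and ann: "\<And>v. v \<in> maxwell_dom \<O> \<Longrightarrow> l2_inner \<O> (maxwell \<O> v) g = 0"
  shows "(\<integral>\<omega>. l2_inner \<O> (exp_integrator S (noise_coeff a b) W dt U0 k \<omega>) g \<partial>M)
    = (\<integral>\<omega>. l2_inner \<O> (U0 \<omega>) g \<partial>M)"
  unfolding exp_integrator_mean(3)[OF g]
  by (intro Bochner_Integration.integral_cong refl group_conserves_annihilator[OF S gen g ann] U0_dom)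

end

lemma
  assumes \<O>: "open \<O>" and v: "v \<in> L2 \<O>"
  shows div_distr_in_Hm1: "div_distr \<O> v \<in> Hm1 \<O>"
    and Hm1_norm_div_distr_le: "Hm1_norm \<O> (div_distr \<O> v) \<le> l2_norm \<O> v"
proof -
  have grad: "grad \<phi> \<in> L2 \<O>" if "\<phi> \<in> test_fun \<O>" for \<phi>
    by (rule test_fun_in_L2[OF grad_in_test_fun[OF that] \<O>])
  have bound: "\<bar>div_distr \<O> v \<phi>\<bar> \<le> l2_norm \<O> v * h1_norm \<O> \<phi>" if \<phi>: "\<phi> \<in> test_fun \<O>" for \<phi>
  proof -
    have "\<bar>div_distr \<O> v \<phi>\<bar> \<le> l2_norm \<O> v * l2_norm \<O> (grad \<phi>)"
      using l2_Cauchy_Schwarz[OF v grad[OF \<phi>]] \<phi> by (simp add: div_distr_def)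
    also have "\<dots> \<le> l2_norm \<O> v * h1_norm \<O> \<phi>"
      by (intro mult_left_mono l2_norm_grad_le_h1_norm l2_norm_nonneg)
    finally show ?thesis .
  qed
  show "div_distr \<O> v \<in> Hm1 \<O>"
  proof (rule Hm1I[OF _ _ bound])
    fix \<phi> \<psi> :: "pt \<Rightarrow> real" and p q :: real assume \<phi>: "\<phi> \<in> test_fun \<O>" and \<psi>: "\<psi> \<in> test_fun \<O>"
    have "(\<lambda>x. p * \<phi> x + q * \<psi> x) \<in> test_fun \<O>"
      using test_fun_lincomb[OF \<phi> \<psi>, of p q] by simp
    then show "div_distr \<O> v (\<lambda>x. p * \<phi> x + q * \<psi> x) = p * div_distr \<O> v \<phi> + q * div_distr \<O> v \<psi>"
      using \<phi> \<psi> l2_inner_lincomb[OF grad[OF \<phi>] grad[OF \<psi>] v, of p q]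
      by (simp add: div_distr_def grad_lincomb[OF \<phi> \<psi>] l2_inner_commute[of \<O> v])
  qed (simp add: div_distr_def)
  show "Hm1_norm \<O> (div_distr \<O> v) \<le> l2_norm \<O> v"
    by (rule Hm1_norm_le[OF bound l2_norm_nonneg])
qed

lemma div_distr_random_elt:
  assumes \<O>: "open \<O>" and X: "random_elt M (L2 \<O>) (l2_norm \<O>) X"
    and int: "integrable M (\<lambda>\<omega>. l2_norm \<O> (X \<omega>))"
  shows "random_elt M (Hm1 \<O>) (Hm1_norm \<O>) (\<lambda>\<omega>. div_distr \<O> (X \<omega>))"
    and "integrable M (\<lambda>\<omega>. Hm1_norm \<O> (div_distr \<O> (X \<omega>)))"
proof -
  have diff: "(\<lambda>\<phi>. div_distr \<O> u \<phi> - div_distr \<O> v \<phi>) = div_distr \<O> (\<lambda>x. u x - v x)"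
    if "u \<in> L2 \<O>" "v \<in> L2 \<O>" for u v
    using that l2_inner_diff[OF that test_fun_in_L2[OF grad_in_test_fun \<O>]]
    by (auto simp: div_distr_def fun_eq_iff)
  show div: "random_elt M (Hm1 \<O>) (Hm1_norm \<O>) (\<lambda>\<omega>. div_distr \<O> (X \<omega>))"
    by (rule random_elt_Lipschitz_image[OF X, where K=1])
      (simp_all add: diff div_distr_in_Hm1[OF \<O>] Hm1_norm_div_distr_le[OF \<O>] L2.diff_mem Hm1_norm_nonneg)
  show "integrable M (\<lambda>\<omega>. Hm1_norm \<O> (div_distr \<O> (X \<omega>)))"
  proof (rule Bochner_Integration.integrable_bound[OF int])
    show "AE \<omega> in M. norm (Hm1_norm \<O> (div_distr \<O> (X \<omega>))) \<le> norm (l2_norm \<O> (X \<omega>))"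
      using random_elt_mem[OF X]
      by (intro AE_I2) (simp add: Hm1_norm_nonneg div_distr_in_Hm1[OF \<O>] Hm1_norm_div_distr_le[OF \<O>]
          l2_norm_nonneg)
  qed (rule Hm1.random_elt_norm_measurable[OF div])
qed

lemma l2_norm_Efld_le: "u \<in> L2 \<O> \<Longrightarrow> l2_norm \<O> (Efld u) \<le> l2_norm \<O> u"
  and l2_norm_Hfld_le: "u \<in> L2 \<O> \<Longrightarrow> l2_norm \<O> (Hfld u) \<le> l2_norm \<O> u"
  unfolding l2_norm_def using l2_inner_em[of u \<O> u] l2_inner_nonneg[of \<O> "Efld u"] l2_inner_nonneg[of \<O> "Hfld u"]
  by simp_all

lemma field_random_elt:
  assumes X: "random_elt M (L2 \<O>) (l2_norm \<O>) X" and int: "integrable M (\<lambda>\<omega>. l2_norm \<O> (X \<omega>))"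
  shows "random_elt M (L2 \<O>) (l2_norm \<O>) (\<lambda>\<omega>. Efld (X \<omega>))"
    and "integrable M (\<lambda>\<omega>. l2_norm \<O> (Efld (X \<omega>)))"
    and "random_elt M (L2 \<O>) (l2_norm \<O>) (\<lambda>\<omega>. Hfld (X \<omega>))"
    and "integrable M (\<lambda>\<omega>. l2_norm \<O> (Hfld (X \<omega>)))"
proof -
  have diff: "(\<lambda>x. Efld u x - Efld v x) = Efld (\<lambda>x. u x - v x)"
      "(\<lambda>x. Hfld u x - Hfld v x) = Hfld (\<lambda>x. u x - v x)" for u v
    by (simp_all add: Efld_def Hfld_def fun_eq_iff)
  show E: "random_elt M (L2 \<O>) (l2_norm \<O>) (\<lambda>\<omega>. Efld (X \<omega>))"
    by (rule random_elt_Lipschitz_image[OF X, where K=1])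
      (simp_all add: diff L2_em_D l2_norm_Efld_le L2.diff_mem l2_norm_nonneg)
  show H: "random_elt M (L2 \<O>) (l2_norm \<O>) (\<lambda>\<omega>. Hfld (X \<omega>))"
    by (rule random_elt_Lipschitz_image[OF X, where K=1])
      (simp_all add: diff L2_em_D l2_norm_Hfld_le L2.diff_mem l2_norm_nonneg)
  show "integrable M (\<lambda>\<omega>. l2_norm \<O> (Efld (X \<omega>)))"
    by (rule Bochner_Integration.integrable_bound[OF int L2.random_elt_norm_measurable[OF E]])
      (auto intro!: AE_I2 l2_norm_Efld_le random_elt_mem[OF X] simp: l2_norm_nonneg)
  show "integrable M (\<lambda>\<omega>. l2_norm \<O> (Hfld (X \<omega>)))"
    by (rule Bochner_Integration.integrable_bound[OF int L2.random_elt_norm_measurable[OF H]])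
      (auto intro!: AE_I2 l2_norm_Hfld_le random_elt_mem[OF X] simp: l2_norm_nonneg)
qed

lemma mean_divergence_eqI:
  assumes M: "finite_measure M" and \<O>: "open \<O>"
    and X: "random_elt M (L2 \<O>) (l2_norm \<O>) X" "integrable M (\<lambda>\<omega>. l2_norm \<O> (X \<omega>))"
    and Y: "random_elt M (L2 \<O>) (l2_norm \<O>) Y" "integrable M (\<lambda>\<omega>. l2_norm \<O> (Y \<omega>))"
    and eq: "\<And>\<phi>. \<phi> \<in> test_fun \<O> \<Longrightarrow>
      (\<integral>\<omega>. l2_inner \<O> (X \<omega>) (grad \<phi>) \<partial>M) = (\<integral>\<omega>. l2_inner \<O> (Y \<omega>) (grad \<phi>) \<partial>M)"
  shows "Hm1_integrable M \<O> (\<lambda>\<omega>. div_distr \<O> (X \<omega>))"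
    and "Hm1_expectation M \<O> (\<lambda>\<omega>. div_distr \<O> (X \<omega>)) = Hm1_expectation M \<O> (\<lambda>\<omega>. div_distr \<O> (Y \<omega>))"
proof -
  show "Hm1_integrable M \<O> (\<lambda>\<omega>. div_distr \<O> (X \<omega>))"
    by (rule Hm1_expectation_eq(1)[OF M div_distr_random_elt[OF \<O> X]])
  show "Hm1_expectation M \<O> (\<lambda>\<omega>. div_distr \<O> (X \<omega>)) = Hm1_expectation M \<O> (\<lambda>\<omega>. div_distr \<O> (Y \<omega>))"
    unfolding Hm1_expectation_eq(2)[OF M div_distr_random_elt[OF \<O> X]]
      Hm1_expectation_eq(2)[OF M div_distr_random_elt[OF \<O> Y]]
  proof
    fix \<phi>
    show "(\<integral>\<omega>. div_distr \<O> (X \<omega>) \<phi> \<partial>M) = (\<integral>\<omega>. div_distr \<O> (Y \<omega>) \<phi> \<partial>M)"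
      using eq[of \<phi>] by (cases "\<phi> \<in> test_fun \<O>") (simp_all add: div_distr_def)
  qed
qed

theorem proposition4p2:
  fixes \<O> :: "(real^3) set"
    and M :: "'a measure" and \<F> :: "real \<Rightarrow> 'a measure"
    and S :: "real \<Rightarrow> (real^3 \<Rightarrow> (real^3) \<times> (real^3)) \<Rightarrow> (real^3 \<Rightarrow> (real^3) \<times> (real^3))"
    and Q sqrtQ :: "(real^3 \<Rightarrow> real) \<Rightarrow> (real^3 \<Rightarrow> real)"
    and e :: "nat \<Rightarrow> real^3 \<Rightarrow> real" and \<eta> :: "nat \<Rightarrow> real"
    and \<beta> :: "nat \<Rightarrow> real \<Rightarrow> 'a \<Rightarrow> real" and W :: "real \<Rightarrow> 'a \<Rightarrow> real^3 \<Rightarrow> real"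
    and U0 :: "'a \<Rightarrow> real^3 \<Rightarrow> (real^3) \<times> (real^3)"
    and U :: "nat \<Rightarrow> 'a \<Rightarrow> real^3 \<Rightarrow> (real^3) \<times> (real^3)"
    and lam1 lam2 dt :: real
  assumes domain: "smooth_domain \<O>"
    and group: "unitary_C0_group \<O> S" and generator: "generated_by_maxwell \<O> S"
    and basis: "stochastic_basis M \<F>"
    and Q: "trace_class_op \<O> Q" and sqrtQ: "is_sqrt_op \<O> sqrtQ Q"
    and onb: "orthonormal_basis \<O> e"
    and eigen: "\<And>k. ae_eq \<O> (Q (e k)) (\<lambda>x. \<eta> k * e k x)"
    and bms: "indep_brownian_motions M \<F> \<beta>"
    and W: "wiener_series \<O> M \<F> sqrtQ e \<beta> W"
    and init: "random_elt (\<F> 0) (maxwell_dom \<O>) (graph_norm \<O>) U0"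
    and moments: "\<And>p::real. p \<ge> 1 \<Longrightarrow> (\<integral>\<^sup>+\<omega>. ennreal (graph_norm \<O> (U0 \<omega>) powr p) \<partial>M) < \<infinity>"
    and dt: "dt > 0"
    and U: "U = exp_integrator S (noise_coeff lam1 lam2) W dt U0"
  shows "\<forall>k\<ge>1.
      Hm1_integrable M \<O> (\<lambda>\<omega>. div_distr \<O> (Efld (U k \<omega>)))
    \<and> Hm1_integrable M \<O> (\<lambda>\<omega>. div_distr \<O> (Efld (U (k - 1) \<omega>)))
    \<and> Hm1_expectation M \<O> (\<lambda>\<omega>. div_distr \<O> (Efld (U k \<omega>)))
        = Hm1_expectation M \<O> (\<lambda>\<omega>. div_distr \<O> (Efld (U (k - 1) \<omega>)))
    \<and> Hm1_integrable M \<O> (\<lambda>\<omega>. div_distr \<O> (Hfld (U k \<omega>)))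
    \<and> Hm1_integrable M \<O> (\<lambda>\<omega>. div_distr \<O> (Hfld (U (k - 1) \<omega>)))
    \<and> Hm1_expectation M \<O> (\<lambda>\<omega>. div_distr \<O> (Hfld (U k \<omega>)))
        = Hm1_expectation M \<O> (\<lambda>\<omega>. div_distr \<O> (Hfld (U (k - 1) \<omega>)))"
proof -
  have \<O>: "open \<O>" using domain by (simp add: smooth_domain_def)
  have M: "finite_measure M"
    using basis by (simp add: stochastic_basis_def prob_space_def)
  have bm: "std_brownian_motion M \<F> (\<beta> k)" for k
    using bms by (simp add: indep_brownian_motions_def)
  have R: "sqrtQ (e k) \<in> L2 \<O>" for k
    using sqrtQ onb by (simp add: is_sqrt_op_def sym_nonneg_op_def bounded_op_def orthonormal_basis_def)
  have init': "random_elt M (maxwell_dom \<O>) (graph_norm \<O>) U0"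
    using random_elt_subalgebra[OF init] basis by (simp add: stochastic_basis_def)
  have U0: "random_elt M (L2 \<O>) (l2_norm \<O>) U0"
    by (rule maxwell_dom_random_elt[OF init'])
  have U0_int: "integrable M (\<lambda>\<omega>. l2_norm \<O> (U0 \<omega>))"
  proof (rule integrableI_bounded)
    have "l2_norm \<O> u \<le> graph_norm \<O> u powr 1" for u
    proof -
      have "l2_norm \<O> u \<le> graph_norm \<O> u" unfolding graph_norm_def by (rule real_le_rsqrt) simp
      then show ?thesis using l2_norm_nonneg[of \<O> u] by simp
    qed
    then have "(\<integral>\<^sup>+\<omega>. ennreal (norm (l2_norm \<O> (U0 \<omega>))) \<partial>M)
        \<le> (\<integral>\<^sup>+\<omega>. ennreal (graph_norm \<O> (U0 \<omega>) powr 1) \<partial>M)"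
      by (intro nn_integral_mono ennreal_leI) (simp add: l2_norm_nonneg)
    also have "\<dots> < \<infinity>" by (rule moments) simp
    finally show "(\<integral>\<^sup>+\<omega>. ennreal (norm (l2_norm \<O> (U0 \<omega>))) \<partial>M) < \<infinity>" .
  qed (rule L2.random_elt_norm_measurable[OF U0])
  note Uk = exp_integrator_mean(1,2)[OF group basis bm R W dt U0 U0_int, of lam1 lam2, folded U]
  have conserved: "(\<integral>\<omega>. l2_inner \<O> (U k \<omega>) g \<partial>M) = (\<integral>\<omega>. l2_inner \<O> (U0 \<omega>) g \<partial>M)"
    if "g \<in> L2 \<O>" "\<And>v. v \<in> maxwell_dom \<O> \<Longrightarrow> l2_inner \<O> (maxwell \<O> v) g = 0" for k g
    unfolding U
    by (rule exp_integrator_mean_conserved[OF group basis bm R W dt U0 U0_int generator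
          random_elt_mem[OF init'] that])
  have grad: "grad \<phi> \<in> L2 \<O>" if "\<phi> \<in> test_fun \<O>" for \<phi>
    by (rule test_fun_in_L2[OF grad_in_test_fun[OF that] \<O>])
  have zero: "(\<lambda>x. 0 :: pt) \<in> L2 \<O>" by (rule L2.zero_mem)
  have E: "(\<integral>\<omega>. l2_inner \<O> (Efld (U k \<omega>)) (grad \<phi>) \<partial>M) = (\<integral>\<omega>. l2_inner \<O> (Efld (U0 \<omega>)) (grad \<phi>) \<partial>M)"
    if \<phi>: "\<phi> \<in> test_fun \<O>" for k \<phi>
    using conserved[OF L2_em_I[OF grad[OF \<phi>] zero] maxwell_orthogonal_grad(1)[OF _ \<phi>], of k]
    by (simp add: l2_inner_def Efld_def inner_prod_def)
  have H: "(\<integral>\<omega>. l2_inner \<O> (Hfld (U k \<omega>)) (grad \<phi>) \<partial>M) = (\<integral>\<omega>. l2_inner \<O> (Hfld (U0 \<omega>)) (grad \<phi>) \<partial>M)"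
    if \<phi>: "\<phi> \<in> test_fun \<O>" for k \<phi>
    using conserved[OF L2_em_I[OF zero grad[OF \<phi>]] maxwell_orthogonal_grad(2)[OF _ \<phi>], of k]
    by (simp add: l2_inner_def Hfld_def inner_prod_def)
  note divE = mean_divergence_eqI[OF M \<O> field_random_elt(1,2)[OF Uk] field_random_elt(1,2)[OF U0 U0_int] E]
  note divH = mean_divergence_eqI[OF M \<O> field_random_elt(3,4)[OF Uk] field_random_elt(3,4)[OF U0 U0_int] H]
  show ?thesis
    using divE(1) divH(1) by (simp add: divE(2) divH(2))
qed

end
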